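(* Fix $0<s<1$. Let $f_0,f_1\in C(\mathbb{R}^n)$ be two distinct, non-negative, symmetric decreasing functions with unit mass, and let $\{f_t\}_{t\in[0,1]}$ be the height function interpolation between $f_0$ and $f_1$. Then $$t\mapsto [f_t]^2_{H^s(\mathbb{R}^n)}$$ is strictly convex for all $0<t<1$.
   Context: Seminorm: $[f]_{H^s(\mathbb{R}^n)}^2=\int_{\mathbb{R}^n}\int_{\mathbb{R}^n}\frac{|f(x)-f(y)|^2}{|x-y|^{n+2s}}\,dx\,dy$. Symmetric decreasing means $f(x)=\Phi(|x|)$ with $\Phi$ non-increasing; unit mass means $\int_{\mathbb{R}^n}f\,dx=1$. Height function: for a non-negative symmetric decreasing $f$ of unit mass, the height function $H:(0,1)\to(0,\|f\|_{L^\infty(\mathbb{R}^n)})$ is defined implicitly by $\int_{\mathbb{R}^n}\min\{f(x),H(m)\}\,dx=m$ for $m\in(0,1)$. It is continuous, strictly increasing and convex, and determines $f$ through $$f(x)=\int_0^1\chi_{B(0,(c_nH'(m))^{-1/n})}(x)\,H'(m)\,dm,$$ where $c_n$ is the volume of the unit ball of $\mathbb{R}^n$. Height function interpolation: if $H_0,H_1$ are the height functions of $f_0,f_1$, set $H_t=(1-t)H_0+tH_1$ for $t\in[0,1]$; $f_t$ is the symmetric decreasing function of unit mass whose height function is $H_t$, i.e. given by the displayed formula with $H$ replaced by $H_t$. *)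

theory Defs
  imports "HOL-Analysis.Analysis" "HOL-Probability.Essential_Supremum"
begin

text \<open>The squared seminorm takes values in the extended reals: it is \<open>\<infinity>\<close> unless
  \<open>f\<close> has finite \<open>H\<^sup>s\<close> energy. On the null set \<open>x = y\<close> the integrand is
  \<open>0 / 0 = 0\<close>.\<close>

definition Hs_seminorm_sq :: "real \<Rightarrow> (real ^ 'n \<Rightarrow> real) \<Rightarrow> ennreal" where
  "Hs_seminorm_sq s f =
     (\<integral>\<^sup>+ y. (\<integral>\<^sup>+ x. ennreal (\<bar>f x - f y\<bar>\<^sup>2 / norm (x - y) powr (real CARD('n) + 2 * s)) \<partial>lborel) \<partial>lborel)"

definition symmetric_decreasing :: "(real ^ 'n \<Rightarrow> real) \<Rightarrow> bool" where
  "symmetric_decreasing f \<longleftrightarrow> (\<exists>\<Phi>. antimono_on {0..} \<Phi> \<and> (\<forall>x. f x = \<Phi> (norm x)))"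

definition unit_mass :: "(real ^ 'n \<Rightarrow> real) \<Rightarrow> bool" where
  "unit_mass f \<longleftrightarrow> has_bochner_integral lborel f 1"

definition Linf_norm :: "(real ^ 'n \<Rightarrow> real) \<Rightarrow> ereal" where
  "Linf_norm f = esssup lborel (\<lambda>x. ereal \<bar>f x\<bar>)"

text \<open>Only the values for \<open>0 < m < 1\<close> are meaningful. The range condition is the codomain
  \<open>(0, \<parallel>f\<parallel>\<^sub>\<infinity>)\<close> of the height function.\<close>

definition height :: "(real ^ 'n \<Rightarrow> real) \<Rightarrow> real \<Rightarrow> real" where
  "height f m = (THE h. 0 < h \<and> ereal h < Linf_norm f \<and> (LINT x|lborel. min (f x) h) = m)"

text \<open>The function determined by a height function \<open>H\<close>. A height function is convex on the
  open unit interval, so it is differentiable there off a countable set, and the unspecified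
  values of \<open>deriv H\<close> on that null set do not affect the integral.\<close>

definition fun_of_height :: "(real \<Rightarrow> real) \<Rightarrow> real ^ 'n \<Rightarrow> real" where
  "fun_of_height H x =
     (LINT m:{0<..<1}|lborel.
        indicator (ball 0 ((measure lborel (ball (0 :: real ^ 'n) 1) * deriv H m)
                             powr (- 1 / real CARD('n)))) x * deriv H m)"

definition height_interpolation ::
    "(real ^ 'n \<Rightarrow> real) \<Rightarrow> (real ^ 'n \<Rightarrow> real) \<Rightarrow> real \<Rightarrow> real ^ 'n \<Rightarrow> real" where
  "height_interpolation f0 f1 t =
     fun_of_height (\<lambda>m. (1 - t) * height f0 m + t * height f1 m)"

text \<open>Strict convexity of an extended-valued function, in the usual sense of convex analysis:
  the inequality is strict between distinct points of the effective domain. Where an end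
  value is \<open>\<infinity>\<close>, the convexity inequality holds trivially and strictness is impossible
  to demand in general.\<close>

definition strictly_convex_on :: "real set \<Rightarrow> (real \<Rightarrow> ennreal) \<Rightarrow> bool" where
  "strictly_convex_on S F \<longleftrightarrow> convex S \<and>
     (\<forall>a\<in>S. \<forall>b\<in>S. \<forall>\<mu>\<in>{0<..<1}. a \<noteq> b \<and> F a < \<infinity> \<and> F b < \<infinity> \<longrightarrow>
        F ((1 - \<mu>) * a + \<mu> * b) < ennreal (1 - \<mu>) * F a + ennreal \<mu> * F b)"

end

theory Submission
  imports Defs
begin

text \<open>Write \<open>g\<^sub>t = (1 - t) g\<^sub>0 + t g\<^sub>1\<close> for the derivative of the interpolated height function. Since the layers
  of \<open>f\<^sub>t\<close> are concentric balls of volume \<open>1 / g\<^sub>t(m)\<close>, the seminorm is the integral over pairs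
  \<open>(m\<^sub>1, m\<^sub>2)\<close> of \<open>2 a b T(r(a), r(b))\<close>, where \<open>a \<ge> b\<close> are the two values of \<open>g\<^sub>t\<close> and \<open>T(r, R)\<close> is the
  interaction of the ball of radius \<open>r\<close> with the complement of the ball of radius \<open>R\<close>. Integrating along rays
  that start in the small ball, and pairing the starting points \<open>x\<close> and \<open>- x\<close>, gives
  \<open>R\<^sup>2\<^sup>s T(r, R) / r\<^sup>n\<close> as a power series in \<open>(r / R)\<^sup>2\<close> with non-negative coefficients. Hence
  \<open>a b T(r(a), r(b))\<close> is a non-negative combination of the monomials
  \<open>b\<^sup>1\<^sup>+\<^sup>p a\<^sup>-\<^sup>q\<close> with \<open>p \<ge> q \<ge> 0\<close>, which are jointly convex; the monomial with \<open>q = 0\<close> occurs and is strictly convex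
  in \<open>b\<close>. Finally \<open>g\<^sub>0\<close> and \<open>g\<^sub>1\<close> differ on a set of positive measure, because a profile is determined
  by the derivative of its height function.\<close>


section \<open>Height functions of continuous symmetric decreasing profiles\<close>

text \<open>Turns almost-everywhere information about superlevel sets of continuous functions into
  pointwise information.\<close>

lemma AE_not_in_open_imp_empty:
  fixes U :: "'a::euclidean_space set"
  assumes "open U" "AE x in lborel. x \<notin> U"
  shows "U = {}"
proof -
  have "U \<in> null_sets lborel"
    using assms by (subst AE_iff_null_sets) auto
  hence "negligible U" by (simp add: negligible_iff_null_sets null_sets_completionI)
  thus ?thesis using open_not_negligible[OF assms(1)] by blast
qed

locale profile =
  fixes f :: "real ^ 'n \<Rightarrow> real"
  assumes cont: "continuous_on UNIV f" and nonneg: "\<And>x. 0 \<le> f x"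
    and sym: "symmetric_decreasing f" and mass: "unit_mass f"
begin

text \<open>\<open>M\<close> is the map that the height function inverts, and \<open>v\<close> is
  its right derivative at positive heights. So \<open>g\<close> is the expected derivative of
  \<open>height f\<close>, given by a formula at every level, including those where
  \<open>deriv\<close> is unspecified.\<close>

definition M :: "real \<Rightarrow> real" where "M h = (LINT x|lborel. min (f x) h)"
definition v :: "real \<Rightarrow> real" where "v h = measure lborel {x. h < f x}"
definition g :: "real \<Rightarrow> real" where "g m = 1 / v (height f m)"

lemma f_measurable [measurable]: "f \<in> borel_measurable borel"
  using cont by (rule borel_measurable_continuous_onI)

lemma f_antimono: "norm x \<le> norm y \<Longrightarrow> f y \<le> f x"
  using sym unfolding symmetric_decreasing_def monotone_on_def by (metis atLeast_iff norm_ge_zero)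

lemma f_le_0: "f x \<le> f 0"
  by (rule f_antimono) simp

lemma integrable_f: "integrable lborel f" and integral_f: "(LINT x|lborel. f x) = 1"
  using mass by (auto simp: unit_mass_def has_bochner_integral_iff)

lemma open_superlevel: "open {x. h < f x}"
  using cont by (auto intro!: open_Collect_less continuous_intros)

lemma integrable_min: "0 \<le> h \<Longrightarrow> integrable lborel (\<lambda>x. min (f x) h)"
  by (rule Bochner_Integration.integrable_bound[OF integrable_f]) (auto simp: nonneg min_def)

lemma integrable_superlevel:
  assumes "0 < h"
  shows "integrable lborel (\<lambda>x. indicator {x. h < f x} x :: real)"
proof (rule Bochner_Integration.integrable_bound)
  show "integrable lborel (\<lambda>x. f x / h)" using integrable_f by simp
  show "AE x in lborel. norm (indicator {x. h < f x} x :: real) \<le> norm (f x / h)"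
    using assms nonneg by (auto simp: indicator_def)
qed simp

lemma v_eq: "v h = (LINT x|lborel. indicator {x. h < f x} x)"
  by (simp add: v_def)

text \<open>Raising the truncation from \<open>h\<close> to \<open>h'\<close> adds exactly
  \<open>h' - h\<close> where \<open>h' < f x\<close>, nothing where \<open>f x\<close> is at most
  \<open>h\<close>, and an amount in between elsewhere. Integrating this gives both bounds.\<close>

lemma M_step:
  assumes "0 < h" "h \<le> h'"
  shows "v h' * (h' - h) \<le> M h' - M h" "M h' - M h \<le> v h * (h' - h)"
proof -
  have e: "M h' - M h = (LINT x|lborel. min (f x) h' - min (f x) h)"
    unfolding M_def using assms by (intro Bochner_Integration.integral_diff[symmetric] integrable_min) auto
  have i: "integrable lborel (\<lambda>x. min (f x) h' - min (f x) h)"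
    using assms by (intro Bochner_Integration.integrable_diff integrable_min) auto
  have i2: "integrable lborel (\<lambda>x. indicator {x. k < f x} x * (h' - h))" if "0 < k" for k
    using integrable_superlevel[OF that] by simp
  have v: "v k * (h' - h) = (LINT x|lborel. indicator {x. k < f x} x * (h' - h))" for k
    by (simp add: v_def)
  show "v h' * (h' - h) \<le> M h' - M h"
    unfolding e v using assms by (intro integral_mono i i2) (auto simp: indicator_def)
  show "M h' - M h \<le> v h * (h' - h)"
    unfolding e v using assms by (intro integral_mono i i2) (auto simp: indicator_def)
qed

lemma v_nonneg: "0 \<le> v h" by (simp add: v_def)

text \<open>The superlevel set is open by continuity and contains the origin.\<close>

lemma v_pos:
  assumes "0 < h" "h < f 0"
  shows "0 < v h"
proof (rule ccontr)
  assume "\<not> 0 < v h"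
  hence "v h = 0" using v_nonneg[of h] by simp
  hence "AE x in lborel. indicator {x. h < f x} x = (0 :: real)"
    unfolding v_eq by (subst (asm) integral_nonneg_eq_0_iff_AE) (auto intro: integrable_superlevel assms)
  hence "AE x in lborel. x \<notin> {x. h < f x}" by eventually_elim (auto simp: indicator_def split: if_splits)
  from AE_not_in_open_imp_empty[OF open_superlevel this] show False using assms by blast
qed

lemma M_mono: "0 < h \<Longrightarrow> h \<le> h' \<Longrightarrow> M h \<le> M h'"
  using M_step(1)[of h h'] mult_nonneg_nonneg[OF v_nonneg[of h'], of "h' - h"] by linarith

lemma M_strict_mono:
  assumes "0 < h" "h < h'" "h' \<le> f 0"
  shows "M h < M h'"
proof -
  \<comment> \<open>An intermediate height is used because \<open>v h'\<close> may vanish when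
    \<open>h' = f 0\<close>.\<close>
  obtain k where k: "h < k" "k < h'" using dense[OF assms(2)] by blast
  have "0 < v k * (k - h)" using k assms v_pos[of k] by simp
  hence "M h < M k" using M_step(1)[of h k] assms k by linarith
  also have "\<dots> \<le> M h'" using k assms by (intro M_mono) auto
  finally show ?thesis .
qed

lemma M_eq_1: "f 0 \<le> h \<Longrightarrow> M h = 1"
proof -
  assume "f 0 \<le> h"
  hence "min (f x) h = f x" for x using f_le_0[of x] by simp
  thus "M h = 1" by (simp add: M_def integral_f)
qed

lemma M_le_1: "0 < h \<Longrightarrow> M h \<le> 1"
  using M_mono[of h "max h (f 0)"] M_eq_1[of "max h (f 0)"] by simp

lemma f_0_pos: "0 < f 0"
proof (rule ccontr)
  assume "\<not> 0 < f 0"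
  hence "f x = 0" for x using f_le_0[of x] nonneg[of x] by simp
  hence "(LINT x|lborel. f x) = 0" by simp
  thus False using integral_f by simp
qed

lemma M_pos:
  assumes "0 < h"
  shows "0 < M h"
proof -
  define k where "k = min h (f 0)"
  have k: "0 < k" "k \<le> h" "k \<le> f 0" using assms f_0_pos by (auto simp: k_def)
  have "0 \<le> M (k / 2)" unfolding M_def using k nonneg by (intro Bochner_Integration.integral_nonneg) auto
  also have "\<dots> < M k" using k by (intro M_strict_mono) auto
  also have "\<dots> \<le> M h" using k by (intro M_mono) auto
  finally show ?thesis .
qed

lemma M_tendsto_0: "(\<lambda>k. M (1 / real (Suc k))) \<longlonglongrightarrow> 0"
proof -
  have "(\<lambda>k. M (1 / real (Suc k))) \<longlonglongrightarrow> (LINT x|(lborel :: (real ^ 'n) measure). 0)"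
    unfolding M_def
  proof (rule integral_dominated_convergence[where w = f])
    show "AE x in lborel. (\<lambda>k. min (f x) (1 / real (Suc k))) \<longlonglongrightarrow> 0"
    proof (rule AE_I2)
      fix x
      have "(\<lambda>k. min (f x) (1 / real (Suc k))) \<longlonglongrightarrow> min (f x) 0"
        using LIMSEQ_inverse_real_of_nat by (intro tendsto_intros) (simp add: divide_inverse)
      thus "(\<lambda>k. min (f x) (1 / real (Suc k))) \<longlonglongrightarrow> 0" using nonneg[of x] by simp
    qed
    show "AE x in lborel. norm (min (f x) (1 / real (Suc k))) \<le> f x" for k
      using nonneg by (auto simp: min_def)
  qed (auto intro: integrable_f)
  thus ?thesis by simp
qed

text \<open>\<open>v\<close> is antitone, so \<open>M\<close> is Lipschitz with constant
  \<open>v a\<close> on \<open>{a..}\<close>.\<close>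

lemma M_continuous:
  assumes "0 < a"
  shows "continuous_on {a..b} M"
proof (rule continuous_on_subset)
  have "dist (M x) (M y) \<le> v a * dist x y" if "x \<in> {a..}" "y \<in> {a..}" for x y
    using that
  proof (induction x y rule: linorder_wlog)
    case (le x y)
    have "v x \<le> v a" unfolding v_eq using le assms
      by (intro integral_mono integrable_superlevel) (auto simp: indicator_def)
    hence "v x * (y - x) \<le> v a * (y - x)" using le by (intro mult_right_mono) auto
    moreover have "M x \<le> M y" using le assms by (intro M_mono) auto
    ultimately show ?case using M_step(2)[of x y] le assms by (simp add: dist_real_def)
  qed (simp add: dist_commute)
  hence "lipschitz_on (v a) {a..} M" by (intro lipschitz_onI v_nonneg)
  thus "continuous_on {a..} M" by (rule lipschitz_on_continuous_on)
qed auto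

text \<open>The maximum at the origin is also the essential supremum: for \<open>c < f 0\<close> the
  set where \<open>f\<close> exceeds \<open>c\<close> is open and non-empty, hence not null.\<close>

lemma Linf_norm_eq: "Linf_norm f = ereal (f 0)"
proof (rule antisym)
  show "Linf_norm f \<le> ereal (f 0)"
    unfolding Linf_norm_def by (rule esssup_I) (auto simp: nonneg f_le_0)
  show "ereal (f 0) \<le> Linf_norm f"
  proof (rule ccontr)
    assume "\<not> ?thesis"
    then obtain c :: real where c: "Linf_norm f < ereal c" "c < f 0"
      by (metis ereal_dense2 less_ereal.simps(1) not_le)
    have "AE x in lborel. ereal \<bar>f x\<bar> \<le> Linf_norm f"
      unfolding Linf_norm_def by (rule esssup_AE)
    hence "AE x in lborel. x \<notin> {x. c < f x}"
    proof eventually_elim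
      case (elim x)
      hence "ereal \<bar>f x\<bar> < ereal c" using c(1) by (rule le_less_trans)
      thus ?case by auto
    qed
    from AE_not_in_open_imp_empty[OF open_superlevel this] show False using c by blast
  qed
qed

text \<open>Existence is the intermediate value theorem between a height of mass below
  \<open>m\<close> and \<open>f 0\<close>, where the mass is 1; uniqueness is strict monotonicity of
  \<open>M\<close> up to \<open>f 0\<close>.\<close>

lemma height_unique:
  assumes "0 < m" "m < 1"
  shows "\<exists>!h. 0 < h \<and> ereal h < Linf_norm f \<and> M h = m"
proof -
  have "\<forall>\<^sub>F k in sequentially. M (1 / real (Suc k)) < m"
    using M_tendsto_0 assms(1) by (rule order_tendstoD(2))
  then obtain k where k: "M (1 / real (Suc k)) < m"
    using eventually_happens'[OF sequentially_bot] by blast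
  define a where "a = 1 / real (Suc k)"
  have a: "0 < a" "M a < m" using k by (auto simp: a_def)
  have a0: "a < f 0" using M_eq_1[of a] a assms by force
  have "\<exists>h. a \<le> h \<and> h \<le> f 0 \<and> M h = m"
    using a a0 assms M_eq_1[of "f 0"] M_continuous[OF a(1), of "f 0"] by (intro IVT') auto
  then obtain h where h: "a \<le> h" "h \<le> f 0" "M h = m" by blast
  moreover have "h \<noteq> f 0" using h M_eq_1[of "f 0"] assms by auto
  ultimately have "0 < h \<and> h < f 0 \<and> M h = m" using a by auto
  moreover have "h = h'" if "0 < h'" "h' < f 0" "M h' = m" for h'
    using M_strict_mono[of h h'] M_strict_mono[of h' h] that h a by (cases h h' rule: linorder_cases) auto
  ultimately show ?thesis by (auto simp: Linf_norm_eq)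
qed

lemma height_props:
  assumes "0 < m" "m < 1"
  shows "0 < height f m" "height f m < f 0" "M (height f m) = m"
  using theI'[OF height_unique[OF assms]] by (auto simp: height_def M_def Linf_norm_eq)

lemma less_height_iff:
  assumes "0 < m" "m < 1" "0 < h"
  shows "h < height f m \<longleftrightarrow> M h < m"
proof
  show "M h < m" if "h < height f m"
    using M_strict_mono[of h "height f m"] height_props[OF assms(1,2)] that assms by auto
  show "h < height f m" if "M h < m"
    using M_mono[of "height f m" h] height_props[OF assms(1,2)] that assms by force
qed

lemma g_pos: "0 < m \<Longrightarrow> m < 1 \<Longrightarrow> 0 < g m"
  unfolding g_def using v_pos height_props by simp

lemma height_mono:
  assumes "0 < m" "m < m'" "m' < 1"
  shows "height f m < height f m'"
  using less_height_iff[of m' "height f m"] height_props[of m] assms by auto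

text \<open>Inverting \<open>M_step\<close> traps each chord slope of \<open>height f\<close>
  between the values of \<open>g\<close> at the two ends. This is the convexity of the height
  function in the form used below.\<close>

lemma height_step:
  assumes "0 < m" "m < m'" "m' < 1"
  shows "g m * (m' - m) \<le> height f m' - height f m" "height f m' - height f m \<le> g m' * (m' - m)"
proof -
  note hm = height_props[of m] height_props[of m'] height_mono[OF assms]
  have "m' - m \<le> v (height f m) * (height f m' - height f m)"
    using M_step(2)[of "height f m" "height f m'"] hm assms by auto
  moreover have "0 < v (height f m)" using v_pos hm assms by auto
  ultimately show "g m * (m' - m) \<le> height f m' - height f m"
    by (simp add: g_def field_simps)
  have "v (height f m') * (height f m' - height f m) \<le> m' - m"
    using M_step(1)[of "height f m" "height f m'"] hm assms by auto
  moreover have "0 < v (height f m')" using v_pos hm assms by auto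
  ultimately show "height f m' - height f m \<le> g m' * (m' - m)"
    by (simp add: g_def field_simps)
qed

lemma g_mono: "mono_on {0<..<1} g"
proof (rule mono_onI)
  fix m m' :: real assume m: "m \<in> {0<..<1}" "m' \<in> {0<..<1}" "m \<le> m'"
  show "g m \<le> g m'"
  proof (cases "m = m'")
    case False
    hence "m < m'" using m by simp
    moreover from this have "g m * (m' - m) \<le> g m' * (m' - m)"
      using height_step[of m m'] m by (intro order_trans[OF height_step(1) height_step(2)]) auto
    ultimately show ?thesis by (intro mult_right_le_imp_le[of "g m" "m' - m"]) auto
  qed simp
qed

lemma g_measurable: "(\<lambda>m. if m \<in> {0<..<1} then g m else 0) \<in> borel_measurable borel"
  using borel_measurable_mono_on_fnc[OF g_mono]
  by (subst (asm) measurable_restrict_space_iff[where c = 0]) auto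

text \<open>By \<open>height_step\<close> the difference quotient between \<open>m\<close> and
  \<open>y\<close> lies between \<open>g m\<close> and \<open>g y\<close>, so its error is at most
  the oscillation of \<open>g\<close>.\<close>

lemma height_has_derivative:
  assumes m: "0 < m" "m < 1" and c: "isCont g m"
  shows "(height f has_real_derivative g m) (at m)"
proof -
  have "((\<lambda>y. (height f y - height f m) / (y - m) - g m) \<longlongrightarrow> 0) (at m)"
  proof (rule Lim_null_comparison)
    have "\<forall>\<^sub>F y in at m. y \<in> {0<..<1} - {m}"
      using m by (intro eventually_at_in_open) auto
    thus "\<forall>\<^sub>F y in at m. norm ((height f y - height f m) / (y - m) - g m) \<le> \<bar>g y - g m\<bar>"
    proof (rule eventually_mono)
      fix y :: real assume y: "y \<in> {0<..<1} - {m}"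
      consider "y < m" | "y = m" | "m < y" by linarith
      thus "norm ((height f y - height f m) / (y - m) - g m) \<le> \<bar>g y - g m\<bar>"
      proof cases
        case 1
        have e: "(height f y - height f m) / (y - m) = (height f m - height f y) / (m - y)"
          using 1 by (simp add: field_simps)
        have "g y \<le> (height f m - height f y) / (m - y)" "(height f m - height f y) / (m - y) \<le> g m"
          using height_step[of y m] y m 1 by (auto simp: pos_le_divide_eq pos_divide_le_eq)
        thus ?thesis unfolding e by auto
      next
        case 3
        have "g m \<le> (height f y - height f m) / (y - m)" "(height f y - height f m) / (y - m) \<le> g y"
          using height_step[of m y] y m 3 by (auto simp: pos_le_divide_eq pos_divide_le_eq)
        thus ?thesis by auto
      qed (use y in auto)
    qed
    have "((\<lambda>y. \<bar>g y - g m\<bar>) \<longlongrightarrow> \<bar>g m - g m\<bar>) (at m)"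
      using c by (intro tendsto_intros) (simp add: isCont_def)
    thus "((\<lambda>y. \<bar>g y - g m\<bar>) \<longlongrightarrow> 0) (at m)" by simp
  qed
  thus ?thesis by (simp add: has_field_derivative_iff LIM_zero_iff)
qed

end

section \<open>A profile is determined by the derivative of its height function\<close>

text \<open>When an interval is split, the increments of \<open>G\<close> add up while the lengths
  shrink by a fixed factor. Iterating the bound therefore drives the increment of \<open>D\<close>
  to zero. It will be applied to the difference of two height functions whose derivatives agree
  almost everywhere.\<close>

lemma increments_eq_of_bisection:
  fixes D G :: "real \<Rightarrow> real" and S :: "real set"
  assumes dense: "\<And>x y. a \<le> x \<Longrightarrow> x < y \<Longrightarrow> y \<le> b \<Longrightarrow> \<exists>c\<in>S. x < c \<and> c < y"
    and bound: "\<And>x y. x \<in> S \<Longrightarrow> y \<in> S \<Longrightarrow> x < y \<Longrightarrow> \<bar>D y - D x\<bar> \<le> (G y - G x) * (y - x)"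
    and mono: "\<And>x y. x \<in> S \<Longrightarrow> y \<in> S \<Longrightarrow> x < y \<Longrightarrow> G x \<le> G y"
    and ab: "a \<in> S" "b \<in> S" "a < b"
  shows "D a = D b"
proof -
  have *: "\<bar>D y - D x\<bar> \<le> (2 / 3) ^ k * ((G y - G x) * (y - x))"
    if "x \<in> S" "y \<in> S" "a \<le> x" "x < y" "y \<le> b" for x y k
    using that
  proof (induction k arbitrary: x y)
    case 0
    thus ?case using bound by simp
  next
    case (Suc k)
    define l where "l = y - x"
    have l: "0 < l" using Suc.prems by (simp add: l_def)
    \<comment> \<open>The midpoint need not belong to \<open>S\<close>; any point of the middle
      third leaves two pieces of at most two thirds of the length.\<close>
    obtain c where c: "c \<in> S" "x + l / 3 < c" "c < y - l / 3"
    proof -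
      have "a \<le> x + l / 3" "x + l / 3 < y - l / 3" "y - l / 3 \<le> b"
        using Suc.prems l by (simp_all add: l_def field_simps)
      from dense[OF this] show ?thesis using that by blast
    qed
    have xc: "x < c" "c < y" using c l by auto
    have "\<bar>D y - D x\<bar> \<le> \<bar>D y - D c\<bar> + \<bar>D c - D x\<bar>" by simp
    also have "\<dots> \<le> (2 / 3) ^ k * ((G y - G c) * (y - c)) + (2 / 3) ^ k * ((G c - G x) * (c - x))"
      using Suc.prems c xc by (intro add_mono Suc.IH) auto
    also have "\<dots> \<le> (2 / 3) ^ k * ((G y - G c) * (2 / 3 * l)) + (2 / 3) ^ k * ((G c - G x) * (2 / 3 * l))"
    proof -
      have "y - c \<le> 2 / 3 * l" "c - x \<le> 2 / 3 * l" using c by (simp_all add: l_def field_simps)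
      thus ?thesis using c xc mono[of x c] mono[of c y] Suc.prems
        by (intro add_mono mult_left_mono) auto
    qed
    also have "\<dots> = (2 / 3) ^ Suc k * (((G y - G c) + (G c - G x)) * l)"
      by (simp only: power_Suc distrib_left distrib_right mult_ac)
    also have "\<dots> = (2 / 3) ^ Suc k * ((G y - G x) * (y - x))"
      by (simp add: l_def)
    finally show ?case .
  qed
  have "(\<lambda>k. (2 / 3) ^ k * ((G b - G a) * (b - a))) \<longlonglongrightarrow> 0 * ((G b - G a) * (b - a))"
    by (intro tendsto_mult_right LIMSEQ_power_zero) auto
  hence "\<bar>D b - D a\<bar> \<le> 0 * ((G b - G a) * (b - a))"
    using *[OF ab(1,2) order_refl ab(3) order_refl] by (intro LIMSEQ_le_const) auto
  thus ?thesis by simp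
qed

lemma AE_interval_dense:
  fixes P :: "real \<Rightarrow> bool"
  assumes "AE x in lborel. x \<in> {0<..<1} \<longrightarrow> P x" "0 \<le> x" "x < y" "y \<le> 1"
  shows "\<exists>c. x < c \<and> c < y \<and> P c"
proof (rule ccontr)
  assume n: "\<not> ?thesis"
  from assms(1) have "AE c in lborel. c \<notin> {x<..<y}"
    by eventually_elim (use n assms in auto)
  from AE_not_in_open_imp_empty[OF _ this] show False using assms by simp
qed

text \<open>If \<open>f1 x < f0 x\<close>, two intermediate heights \<open>c < c'\<close> and
  \<open>M_step\<close> show that \<open>{f0 > c'}\<close> has at most the volume of
  \<open>{f1 > c}\<close>. But the latter lies in the open ball of radius \<open>norm x\<close>,
  while the former is open and contains the closed one, so it has strictly larger volume.\<close>

lemma profile_le_of_M_eq: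
  fixes f0 f1 :: "real ^ 'n \<Rightarrow> real"
  assumes p0: "profile f0" and p1: "profile f1"
    and M: "\<And>h. 0 < h \<Longrightarrow> profile.M f0 h = profile.M f1 h"
  shows "f0 x \<le> f1 x"
proof (rule ccontr)
  interpret p0: profile f0 by (rule p0)
  interpret p1: profile f1 by (rule p1)
  assume "\<not> ?thesis"
  hence lt: "f1 x < f0 x" by simp
  define c where "c = f1 x + (f0 x - f1 x) / 3"
  define c' where "c' = f1 x + 2 * (f0 x - f1 x) / 3"
  have c: "f1 x < c" "c < c'" "c' < f0 x" using lt by (auto simp: c_def c'_def field_simps)
  have c0: "0 < c" using c p1.nonneg[of x] by linarith
  have "p0.v c' * (c' - c) \<le> p0.M c' - p0.M c" using p0.M_step(1)[of c c'] c c0 by simp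
  also have "\<dots> = p1.M c' - p1.M c" using M[of c] M[of c'] c c0 by simp
  also have "\<dots> \<le> p1.v c * (c' - c)" using p1.M_step(2)[of c c'] c c0 by simp
  finally have v: "p0.v c' \<le> p1.v c" using c by simp
  define A where "A = {y. c' < f0 y}"
  define B where "B = {y. c < f1 y}"
  have B: "y \<in> B \<Longrightarrow> norm y < norm x" for y
    using p1.f_antimono[of x y] c by (force simp: B_def)
  have A: "norm y \<le> norm x \<Longrightarrow> y \<in> A" for y
    using p0.f_antimono[of y x] c by (force simp: A_def)
  define U where "U = A \<inter> {y. norm x < norm y}"
  have oU: "open U" unfolding U_def A_def
    by (intro open_Int p0.open_superlevel open_Collect_less continuous_intros)
  have "AE y in lborel. y \<notin> U"
  proof -
    have i: "integrable lborel (\<lambda>y. indicator A y :: real)" "integrable lborel (\<lambda>y. indicator B y :: real)"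
      unfolding A_def B_def using c c0 by (auto intro!: p0.integrable_superlevel p1.integrable_superlevel)
    have "(LINT y|lborel. indicator A y - indicator B y :: real) \<le> 0"
      using v i by (simp add: p0.v_eq p1.v_eq A_def B_def)
    moreover have nn: "0 \<le> indicator A y - (indicator B y :: real)" for y
      using A[of y] B[of y] by (auto simp: indicator_def)
    ultimately have "(LINT y|lborel. indicator A y - indicator B y :: real) = 0"
      using Bochner_Integration.integral_nonneg[OF nn] by (auto intro: antisym)
    hence "AE y in lborel. indicator A y - (indicator B y :: real) = 0"
      using i nn by (subst (asm) integral_nonneg_eq_0_iff_AE) auto
    thus ?thesis
      by eventually_elim (use B in \<open>force simp: U_def indicator_def split: if_splits\<close>)
  qed
  from AE_not_in_open_imp_empty[OF oU this] have "U = {}" .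
  moreover have "\<exists>y\<in>A. norm x < norm y"
  proof -
    have "open A" unfolding A_def by (rule p0.open_superlevel)
    moreover have "x \<in> A" using A by simp
    ultimately obtain e where e: "0 < e" "ball x e \<subseteq> A" by (rule openE)
    \<comment> \<open>The outward unit direction at \<open>x\<close>; at the origin any unit vector
      serves.\<close>
    define u where "u = (if x = 0 then axis undefined 1 else x /\<^sub>R norm x)"
    have u: "norm u = 1" by (simp add: u_def)
    have "x = norm x *\<^sub>R u" by (simp add: u_def)
    hence "x + (e / 2) *\<^sub>R u = (norm x + e / 2) *\<^sub>R u" by (metis scaleR_left_distrib)
    hence "norm (x + (e / 2) *\<^sub>R u) = norm x + e / 2" using e u by simp
    moreover have "x + (e / 2) *\<^sub>R u \<in> ball x e" using e u by (simp add: dist_norm)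
    ultimately show ?thesis using e by (intro bexI[of _ "x + (e / 2) *\<^sub>R u"]) auto
  qed
  ultimately show False by (auto simp: U_def)
qed

text \<open>The difference of the heights is constant on the dense set \<open>S\<close> where the
  derivatives agree, and it vanishes because both heights tend to 0 at level 0. Heights agreeing on
  a dense set of levels determine \<open>M\<close> through \<open>less_height_iff\<close>, and
  \<open>M\<close> determines the profile.\<close>

lemma profile_eq_of_AE_g_eq:
  fixes f0 f1 :: "real ^ 'n \<Rightarrow> real"
  assumes p0: "profile f0" and p1: "profile f1"
    and ae: "AE m in lborel. m \<in> {0<..<1} \<longrightarrow> profile.g f0 m = profile.g f1 m"
  shows "f0 = f1"
proof -
  interpret p0: profile f0 by (rule p0)
  interpret p1: profile f1 by (rule p1)
  define D where "D m = height f0 m - height f1 m" for m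
  define S where "S = {m. 0 < m \<and> m < 1 \<and> p0.g m = p1.g m}"
  have dense: "\<exists>c\<in>S. x < c \<and> c < y" if xy: "0 \<le> x" "x < y" "y \<le> 1" for x y
  proof -
    obtain c where "x < c" "c < y" "p0.g c = p1.g c" using AE_interval_dense[OF ae xy] by blast
    thus ?thesis using xy by (intro bexI[of _ c]) (auto simp: S_def)
  qed
  have Dc: "D x = D y" if "x \<in> S" "y \<in> S" "x < y" for x y
  proof (rule increments_eq_of_bisection[where S = S and G = p0.g and D = D and a = x and b = y])
    show "\<bar>D y - D x\<bar> \<le> (p0.g y - p0.g x) * (y - x)" if "x \<in> S" "y \<in> S" "x < y" for x y
      \<comment> \<open>At points of \<open>S\<close> the two functions \<open>g\<close> coincide,
        so both height increments lie in the same interval.\<close>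
      using p0.height_step[of x y] p1.height_step[of x y] that
      by (auto simp: S_def D_def abs_le_iff algebra_simps)
    show "p0.g x \<le> p0.g y" if "x \<in> S" "y \<in> S" "x < y" for x y
      using mono_onD[OF p0.g_mono, of x y] that by (auto simp: S_def)
    show "\<exists>c\<in>S. u < c \<and> c < w" if "x \<le> u" "u < w" "w \<le> y" for u w
      using dense[of u w] that \<open>x \<in> S\<close> \<open>y \<in> S\<close> by (auto simp: S_def)
  qed (use that in auto)
  have D0: "D x = 0" if x: "x \<in> S" for x
  proof (rule ccontr)
    assume "D x \<noteq> 0"
    define e where "e = \<bar>D x\<bar>"
    have e: "0 < e" using \<open>D x \<noteq> 0\<close> by (simp add: e_def)
    \<comment> \<open>A level of \<open>S\<close> below both masses \<open>p0.M e\<close> and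
      \<open>p1.M e\<close> has both heights in the interval from 0 to \<open>e\<close>, with 0
      excluded, so they differ by less than \<open>e\<close>.\<close>
    have "0 < min x (min (p0.M e) (p1.M e))"
      using p0.M_pos[OF e] p1.M_pos[OF e] x by (auto simp: S_def)
    then obtain m where m: "m \<in> S" "m < x" "m < p0.M e" "m < p1.M e"
    proof -
      have "min x (min (p0.M e) (p1.M e)) \<le> 1" using x by (auto simp: S_def)
      from dense[OF order_refl \<open>0 < min x _\<close> this] that show ?thesis by auto
    qed
    have m01: "0 < m" "m < 1" using m by (auto simp: S_def)
    have "height f0 m \<le> e" "height f1 m \<le> e"
      using p0.less_height_iff[OF m01 e] p1.less_height_iff[OF m01 e] m by auto
    hence "\<bar>D m\<bar> < e"
      using p0.height_props(1)[OF m01] p1.height_props(1)[OF m01] by (auto simp: D_def)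
    moreover have "D m = D x" using Dc[of m x] m x by simp
    ultimately show False by (simp add: e_def)
  qed
  have M: "p0.M h = p1.M h" if h: "0 < h" for h
  proof (rule ccontr)
    assume "p0.M h \<noteq> p1.M h"
    hence "min (p0.M h) (p1.M h) < max (p0.M h) (p1.M h)" by auto
    moreover have "0 \<le> min (p0.M h) (p1.M h)" "max (p0.M h) (p1.M h) \<le> 1"
      using p0.M_pos[OF h] p1.M_pos[OF h] p0.M_le_1[OF h] p1.M_le_1[OF h] by auto
    ultimately obtain m where m: "m \<in> S" "min (p0.M h) (p1.M h) < m" "m < max (p0.M h) (p1.M h)"
      using dense by blast
    have m01: "0 < m" "m < 1" using m by (auto simp: S_def)
    have "height f0 m = height f1 m" using D0[OF m(1)] by (simp add: D_def)
    thus False using p0.less_height_iff[OF m01 h] p1.less_height_iff[OF m01 h] m by (auto simp: min_def max_def split: if_splits)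
  qed
  show ?thesis
  proof
    fix x
    show "f0 x = f1 x"
      using profile_le_of_M_eq[OF p0 p1 M] profile_le_of_M_eq[OF p1 p0 M[symmetric]] by (intro antisym)
  qed
qed


section \<open>Convexity of monomials\<close>

text \<open>The left side is the tangent plane at (1, 1). After division by \<open>x\<close> the
  inequality is a sum of three instances of \<open>1 + z \<le> exp z\<close>; one of them carries
  the weight \<open>p - q\<close>, which is where \<open>q \<le> p\<close> enters.\<close>

lemma monomial_tangent:
  fixes x y p q :: real
  assumes "0 < x" "0 < y" "0 \<le> q" "q \<le> p"
  shows "1 + (1 + p) * (x - 1) - q * (y - 1) \<le> x powr (1 + p) * y powr (- q)"
proof -
  have e1: "1 + (p * ln x - q * ln y) \<le> x powr p * y powr (- q)"
  proof -
    have "x powr p * y powr (- q) = exp (p * ln x - q * ln y)"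
      using assms by (simp add: powr_def exp_diff exp_minus divide_inverse)
    thus ?thesis using exp_ge_add_one_self[of "p * ln x - q * ln y"] by simp
  qed
  have e2: "q * (1 + (ln y - ln x)) \<le> q * (y / x)"
    using exp_ge_add_one_self[of "ln y - ln x"] assms
    by (intro mult_left_mono) (auto simp: exp_diff)
  have e3: "(p - q) * (1 - ln x) \<le> (p - q) * (1 / x)"
    using exp_ge_add_one_self[of "- ln x"] assms
    by (intro mult_left_mono) (auto simp: exp_minus divide_inverse)
  \<comment> \<open>All logarithms cancel in the sum of the three bounds.\<close>
  have "1 + p \<le> x powr p * y powr (- q) + q * (y / x) + (p - q) * (1 / x)"
    using e1 e2 e3 by (simp add: algebra_simps)
  hence "(1 + p) * x \<le> (x powr p * y powr (- q) + q * (y / x) + (p - q) * (1 / x)) * x"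
    using assms by (intro mult_right_mono) auto
  also have "\<dots> = (x * x powr p) * y powr (- q) + q * y + (p - q)"
    using assms(1) by (simp add: distrib_right)
  also have "x * x powr p = x powr (1 + p)"
    using assms(1) by (simp add: powr_add)
  finally show ?thesis by (simp add: algebra_simps)
qed

text \<open>The case \<open>q = 0\<close> of the preceding argument, made strict because
  \<open>ln z = z - 1\<close> only at \<open>z = 1\<close>.\<close>

lemma power_tangent_strict:
  fixes x p :: real
  assumes "0 < x" "0 < p" "x \<noteq> 1"
  shows "1 + (1 + p) * (x - 1) < x powr (1 + p)"
proof -
  have e1: "1 + p * ln x \<le> x powr p"
    using exp_ge_add_one_self[of "p * ln x"] assms by (simp add: powr_def)
  have "ln (1 / x) \<noteq> 1 / x - 1" "ln (1 / x) \<le> 1 / x - 1"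
    using ln_eq_minus_one[of "1 / x"] ln_le_minus_one[of "1 / x"] assms by auto
  hence "p * (1 - ln x) < p * (1 / x)"
    using assms by (intro mult_strict_left_mono) (auto simp: ln_div)
  hence "1 + p < x powr p + p * (1 / x)"
    using e1 by (simp add: algebra_simps)
  hence "(1 + p) * x < (x powr p + p * (1 / x)) * x"
    using assms by (intro mult_strict_right_mono) auto
  also have "\<dots> = x powr (1 + p) + p"
    using assms(1) by (simp add: powr_add distrib_right)
  finally show ?thesis by (simp add: algebra_simps)
qed

lemma convex_combination_pos:
  fixes x y \<mu> :: real
  assumes "0 < x" "0 < y" "0 < \<mu>" "\<mu> < 1"
  shows "0 < (1 - \<mu>) * x + \<mu> * y"
  using assms by (simp add: add_pos_pos)

text \<open>Rescaling moves the tangent inequality from (1, 1) to the intermediate point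
  \<open>(b, a)\<close>; the weighted average of its instances at the two end points is the
  claim.\<close>

lemma monomial_convex:
  fixes a0 a1 b0 b1 p q \<mu> :: real
  assumes pos: "0 < a0" "0 < a1" "0 < b0" "0 < b1" "0 \<le> q" "q \<le> p" "0 < \<mu>" "\<mu> < 1"
  shows "((1 - \<mu>) * b0 + \<mu> * b1) powr (1 + p) * ((1 - \<mu>) * a0 + \<mu> * a1) powr (- q)
    \<le> (1 - \<mu>) * (b0 powr (1 + p) * a0 powr (- q)) + \<mu> * (b1 powr (1 + p) * a1 powr (- q))"
proof -
  define a where "a = (1 - \<mu>) * a0 + \<mu> * a1"
  define b where "b = (1 - \<mu>) * b0 + \<mu> * b1"
  have ab: "0 < a" "0 < b" using convex_combination_pos pos by (auto simp: a_def b_def)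
  define \<Psi> where "\<Psi> = b powr (1 + p) * a powr (- q)"
  have \<Psi>: "0 < \<Psi>" using ab by (simp add: \<Psi>_def)
  have t: "\<Psi> * (1 + (1 + p) * (b' / b - 1) - q * (a' / a - 1)) \<le> b' powr (1 + p) * a' powr (- q)"
    if "0 < a'" "0 < b'" for a' b'
  proof -
    have "\<Psi> * (1 + (1 + p) * (b' / b - 1) - q * (a' / a - 1))
        \<le> \<Psi> * ((b' / b) powr (1 + p) * (a' / a) powr (- q))"
      using monomial_tangent[of "b' / b" "a' / a" q p] that ab pos \<Psi>
      by (intro mult_left_mono) auto
    also have "\<dots> = b' powr (1 + p) * a' powr (- q)"
      using that ab by (simp add: \<Psi>_def powr_divide)
    finally show ?thesis .
  qed
  \<comment> \<open>The ratios average to 1, so the linear terms of the tangent plane drop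
    out.\<close>
  have lin: "(1 - \<mu>) * (b0 / b) + \<mu> * (b1 / b) = 1" "(1 - \<mu>) * (a0 / a) + \<mu> * (a1 / a) = 1"
    using ab by (simp_all add: a_def b_def add_divide_distrib[symmetric])
  have "\<Psi> = \<Psi> * (1 + (1 + p) * (((1 - \<mu>) * (b0 / b) + \<mu> * (b1 / b)) - 1)
      - q * (((1 - \<mu>) * (a0 / a) + \<mu> * (a1 / a)) - 1))"
    by (simp only: lin) simp
  also have "\<dots> = (1 - \<mu>) * (\<Psi> * (1 + (1 + p) * (b0 / b - 1) - q * (a0 / a - 1)))
    + \<mu> * (\<Psi> * (1 + (1 + p) * (b1 / b - 1) - q * (a1 / a - 1)))"
    by (simp add: algebra_simps)
  also have "\<dots> \<le> (1 - \<mu>) * (b0 powr (1 + p) * a0 powr (- q)) + \<mu> * (b1 powr (1 + p) * a1 powr (- q))"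
    using pos by (intro add_mono mult_left_mono t) auto
  finally show ?thesis by (simp add: \<Psi>_def a_def b_def)
qed

lemma power_strictly_convex:
  fixes b0 b1 p \<mu> :: real
  assumes pos: "0 < b0" "0 < b1" "0 < p" "0 < \<mu>" "\<mu> < 1" and "b0 \<noteq> b1"
  shows "((1 - \<mu>) * b0 + \<mu> * b1) powr (1 + p) < (1 - \<mu>) * b0 powr (1 + p) + \<mu> * b1 powr (1 + p)"
proof -
  define b where "b = (1 - \<mu>) * b0 + \<mu> * b1"
  have b: "0 < b" using convex_combination_pos pos by (auto simp: b_def)
  have t: "b powr (1 + p) * (1 + (1 + p) * (b' / b - 1)) < b' powr (1 + p)"
    if "0 < b'" "b' \<noteq> b" for b'
  proof -
    have "b powr (1 + p) * (1 + (1 + p) * (b' / b - 1)) < b powr (1 + p) * (b' / b) powr (1 + p)"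
      using power_tangent_strict[of "b' / b" p] that b pos
      by (intro mult_strict_left_mono) auto
    also have "\<dots> = b' powr (1 + p)"
      using that b by (simp add: powr_divide)
    finally show ?thesis .
  qed
  have lin: "(1 - \<mu>) * (b0 / b) + \<mu> * (b1 / b) = 1"
    using b by (simp add: b_def add_divide_distrib[symmetric])
  have ne: "b0 \<noteq> b" "b1 \<noteq> b"
  proof -
    have "b - b0 = \<mu> * (b1 - b0)" "b - b1 = (1 - \<mu>) * (b0 - b1)"
      by (simp_all add: b_def algebra_simps)
    moreover have "\<mu> * (b1 - b0) \<noteq> 0" "(1 - \<mu>) * (b0 - b1) \<noteq> 0" using assms by auto
    ultimately show "b0 \<noteq> b" "b1 \<noteq> b" by force+
  qed
  have "b powr (1 + p) = b powr (1 + p) * (1 + (1 + p) * (((1 - \<mu>) * (b0 / b) + \<mu> * (b1 / b)) - 1))"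
    by (simp only: lin) simp
  also have "\<dots> = (1 - \<mu>) * (b powr (1 + p) * (1 + (1 + p) * (b0 / b - 1)))
    + \<mu> * (b powr (1 + p) * (1 + (1 + p) * (b1 / b - 1)))"
    by (simp add: algebra_simps)
  also have "\<dots> < (1 - \<mu>) * b0 powr (1 + p) + \<mu> * b1 powr (1 + p)"
    using pos ne by (intro add_strict_mono mult_strict_left_mono t) auto
  finally show ?thesis by (simp add: b_def)
qed

section \<open>Binomial series with non-negative coefficients\<close>

text \<open>The coefficient of \<open>x ^ k\<close> in \<open>(1 - x) powr (- \<beta>)\<close>. The
  rising factorial makes its sign evident for positive \<open>\<beta>\<close>.\<close>

definition neg_binom :: "real \<Rightarrow> nat \<Rightarrow> real" where
  "neg_binom \<beta> k = pochhammer \<beta> k / fact k"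

lemma neg_binom_nonneg: "0 < \<beta> \<Longrightarrow> 0 \<le> neg_binom \<beta> k"
  by (simp add: neg_binom_def pochhammer_nonneg)

lemma neg_binom_0 [simp]: "neg_binom \<beta> 0 = 1"
  by (simp add: neg_binom_def)

lemma neg_binom_sums:
  fixes x \<beta> :: real
  assumes "\<bar>x\<bar> < 1"
  shows "(\<lambda>k. neg_binom \<beta> k * x ^ k) sums (1 - x) powr (- \<beta>)"
proof -
  have "(\<lambda>k. ((- \<beta>) gchoose k) * (- x) ^ k) sums (1 + (- x)) powr (- \<beta>)"
    using assms by (intro gen_binomial_real) auto
  also have "(\<lambda>k. ((- \<beta>) gchoose k) * (- x) ^ k) = (\<lambda>k. neg_binom \<beta> k * x ^ k)"
  proof
    fix k
    have "(- x) ^ k = (- 1) ^ k * x ^ k" by (rule power_minus)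
    moreover have "(- 1) ^ k * (- 1) ^ k = (1 :: real)" by (simp flip: power_mult_distrib)
    ultimately show "((- \<beta>) gchoose k) * (- x) ^ k = neg_binom \<beta> k * x ^ k"
      by (simp add: neg_binom_def gbinomial_pochhammer)
  qed
  finally show ?thesis by simp
qed

text \<open>Adding the series at \<open>x\<close> and \<open>- x\<close> removes the odd powers, the
  only ones that can be negative. This is the gain from pairing opposite starting points.\<close>

lemma neg_binom_even_sums:
  fixes x \<beta> :: real
  assumes "\<bar>x\<bar> < 1"
  shows "(\<lambda>j. 2 * neg_binom \<beta> (2 * j) * x ^ (2 * j)) sums ((1 - x) powr (- \<beta>) + (1 + x) powr (- \<beta>))"
proof -
  have "(\<lambda>k. neg_binom \<beta> k * x ^ k + neg_binom \<beta> k * (- x) ^ k)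
      sums ((1 - x) powr (- \<beta>) + (1 - (- x)) powr (- \<beta>))"
    using assms by (intro sums_add neg_binom_sums) auto
  note sm = this
  have *: "(\<lambda>k. if even k then 2 * neg_binom \<beta> k * x ^ k else 0)
      sums ((1 - x) powr (- \<beta>) + (1 + x) powr (- \<beta>))"
  proof -
    have "(\<lambda>k. if even k then 2 * neg_binom \<beta> k * x ^ k else 0)
        = (\<lambda>k. neg_binom \<beta> k * x ^ k + neg_binom \<beta> k * (- x) ^ k)"
      by (auto simp: fun_eq_iff power_minus_odd)
    thus ?thesis using sm by simp
  qed
  have "(\<lambda>j. (if even (2 * j) then 2 * neg_binom \<beta> (2 * j) * x ^ (2 * j) else 0))
      sums ((1 - x) powr (- \<beta>) + (1 + x) powr (- \<beta>))"
    using * by (subst sums_mono_reindex[of "\<lambda>j. 2 * j"]) (auto simp: strict_mono_def)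
  thus ?thesis by simp
qed

lemma ennreal_suminf_sums:
  assumes "f sums x" "\<And>i. 0 \<le> f i"
  shows "(\<Sum>i. ennreal (f i)) = ennreal x"
  using assms suminf_ennreal_eq by blast

text \<open>Both series have non-negative coefficients; this is what makes the kernel a positive
  combination of monomials in the ratio of the radii.\<close>

lemma ray_series:
  fixes s d k z :: real
  assumes s: "0 < s" and d: "0 \<le> d" and z: "0 < z" and lt: "z\<^sup>2 * (d + k\<^sup>2) < 1"
  defines "Q \<equiv> sqrt (1 - d * z\<^sup>2)"
  shows "\<bar>z * k\<bar> < Q"
    and "ennreal ((Q - z * k) powr (- 2 * s) + (Q + z * k) powr (- 2 * s)) =
      (\<Sum>j. \<Sum>i. ennreal (2 * neg_binom (2 * s) (2 * j) * neg_binom (s + j) i * k ^ (2 * j) * d ^ i)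
        * ennreal (z ^ (2 * (i + j))))"
proof -
  have dz: "d * z\<^sup>2 < 1"
  proof -
    have "d * z\<^sup>2 \<le> z\<^sup>2 * (d + k\<^sup>2)" by (simp add: algebra_simps)
    thus ?thesis using lt by simp
  qed
  have Q2: "Q\<^sup>2 = 1 - d * z\<^sup>2" and Qpos: "0 < Q" using dz by (auto simp: Q_def)
  have "(z * k)\<^sup>2 < Q\<^sup>2" using lt by (simp add: Q2 power_mult_distrib algebra_simps)
  thus PQ: "\<bar>z * k\<bar> < Q" using Qpos by (metis abs_le_square_iff abs_of_pos not_le)
  \<comment> \<open>With this ratio the two bases become \<open>Q * (1 - x)\<close> and
    \<open>Q * (1 + x)\<close>, so that \<open>Q\<close> factors out.\<close>
  define x where "x = z * k / Q"
  have x: "\<bar>x\<bar> < 1" using PQ Qpos by (simp add: x_def)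
  have e: "(Q - z * k) powr (- 2 * s) + (Q + z * k) powr (- 2 * s)
      = Q powr (- 2 * s) * ((1 - x) powr (- (2 * s)) + (1 + x) powr (- (2 * s)))"
  proof -
    have "Q - z * k = Q * (1 - x)" "Q + z * k = Q * (1 + x)"
      using Qpos by (simp_all add: x_def field_simps)
    hence e: "(Q - z * k) powr (- 2 * s) = (Q * (1 - x)) powr (- 2 * s)"
      "(Q + z * k) powr (- 2 * s) = (Q * (1 + x)) powr (- 2 * s)" by (simp_all only:)
    have "0 < 1 - x" "0 < 1 + x" using x by auto
    thus ?thesis unfolding e using Qpos by (subst (1 2) powr_mult) (simp_all add: distrib_left)
  qed
  have sm: "(\<lambda>j. Q powr (- 2 * s) * (2 * neg_binom (2 * s) (2 * j) * x ^ (2 * j)))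
      sums ((Q - z * k) powr (- 2 * s) + (Q + z * k) powr (- 2 * s))"
    unfolding e by (intro sums_mult neg_binom_even_sums x)
  \<comment> \<open>The denominator of \<open>x ^ (2 * j)\<close> merges with the prefactor into an
    integer multiple of \<open>- 2\<close> plus \<open>- 2 * s\<close> in the exponent of
    \<open>Q\<close>. The square root thus disappears, and a second binomial series, in
    \<open>d * z\<^sup>2\<close>, applies.\<close>
  have trm: "Q powr (- 2 * s) * (2 * neg_binom (2 * s) (2 * j) * x ^ (2 * j))
      = 2 * neg_binom (2 * s) (2 * j) * (z * k) ^ (2 * j) * (1 - d * z\<^sup>2) powr (- (s + j))" for j
  proof -
    have "Q powr (- 2 * s) * inverse (Q ^ (2 * j)) = Q powr (- 2 * s) * Q powr (- real (2 * j))"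
      using powr_realpow[OF Qpos, of "2 * j"] by (simp add: powr_minus)
    also have "\<dots> = Q powr (2 * (- (s + j)))"
      by (simp add: powr_add[symmetric] distrib_left)
    also have "\<dots> = (Q\<^sup>2) powr (- (s + j))"
      using powr_powr[of Q 2 "- (s + j)"] powr_realpow[OF Qpos, of 2] by simp
    finally have e: "Q powr (- 2 * s) * inverse (Q ^ (2 * j)) = (1 - d * z\<^sup>2) powr (- (s + j))"
      by (simp only: Q2)
    have "x ^ (2 * j) = (z * k) ^ (2 * j) * inverse (Q ^ (2 * j))"
      unfolding x_def power_divide by (simp only: divide_inverse)
    thus ?thesis by (simp only: e[symmetric] mult_ac)
  qed
  have inner: "ennreal (2 * neg_binom (2 * s) (2 * j) * (z * k) ^ (2 * j) * (1 - d * z\<^sup>2) powr (- (s + j)))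
    = (\<Sum>i. ennreal (2 * neg_binom (2 * s) (2 * j) * neg_binom (s + j) i * k ^ (2 * j) * d ^ i)
        * ennreal (z ^ (2 * (i + j))))" for j
  proof -
    have "(\<lambda>i. (2 * neg_binom (2 * s) (2 * j) * (z * k) ^ (2 * j)) * (neg_binom (s + j) i * (d * z\<^sup>2) ^ i))
      sums ((2 * neg_binom (2 * s) (2 * j) * (z * k) ^ (2 * j)) * (1 - d * z\<^sup>2) powr (- (s + j)))"
      using dz d by (intro sums_mult neg_binom_sums) auto
    moreover have "(2 * neg_binom (2 * s) (2 * j) * (z * k) ^ (2 * j)) * (neg_binom (s + j) i * (d * z\<^sup>2) ^ i)
      = (2 * neg_binom (2 * s) (2 * j) * neg_binom (s + j) i * k ^ (2 * j) * d ^ i) * z ^ (2 * (i + j))" for i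
      by (simp add: power_mult_distrib power_add power_mult)
    ultimately have "(\<lambda>i. (2 * neg_binom (2 * s) (2 * j) * neg_binom (s + j) i * k ^ (2 * j) * d ^ i) * z ^ (2 * (i + j)))
      sums ((2 * neg_binom (2 * s) (2 * j) * (z * k) ^ (2 * j)) * (1 - d * z\<^sup>2) powr (- (s + j)))" by simp
    note sums = this
    have nn: "0 \<le> 2 * neg_binom (2 * s) (2 * j) * neg_binom (s + j) i * k ^ (2 * j) * d ^ i" for i
      using s d by (auto intro!: mult_nonneg_nonneg neg_binom_nonneg add_pos_nonneg)
    have z2: "0 \<le> z ^ (2 * (i + j))" for i using z by simp
    show ?thesis
      using ennreal_suminf_sums[OF sums mult_nonneg_nonneg[OF nn z2]]
      by (simp only: ennreal_mult[OF nn z2])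
  qed
  have "ennreal ((Q - z * k) powr (- 2 * s) + (Q + z * k) powr (- 2 * s)) =
    (\<Sum>j. ennreal (Q powr (- 2 * s) * (2 * neg_binom (2 * s) (2 * j) * x ^ (2 * j))))"
  proof (rule ennreal_suminf_sums[OF sm, symmetric])
    fix j
    have "0 \<le> x ^ (2 * j)" by simp
    thus "0 \<le> Q powr (- 2 * s) * (2 * neg_binom (2 * s) (2 * j) * x ^ (2 * j))"
      using s by (intro mult_nonneg_nonneg neg_binom_nonneg) auto
  qed
  thus "ennreal ((Q - z * k) powr (- 2 * s) + (Q + z * k) powr (- 2 * s)) =
      (\<Sum>j. \<Sum>i. ennreal (2 * neg_binom (2 * s) (2 * j) * neg_binom (s + j) i * k ^ (2 * j) * d ^ i)
        * ennreal (z ^ (2 * (i + j))))"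
    by (simp only: trm inner)
qed


section \<open>Integration along rays\<close>

lemma nn_integral_powr_tail:
  fixes p \<rho> :: real
  assumes "0 < p" "0 < \<rho>"
  shows "(\<integral>\<^sup>+l. (if \<rho> \<le> l then ennreal (l powr (- 1 - p)) else 0) \<partial>lborel) = ennreal (\<rho> powr (- p) / p)"
proof -
  have "(\<integral>\<^sup>+l. ennreal (l powr (- 1 - p)) * indicator {\<rho>..} l \<partial>lborel) = ennreal (0 - (- (\<rho> powr (- p)) / p))"
  proof (rule nn_integral_FTC_atLeast)
    show "((\<lambda>l. - (l powr (- p)) / p) has_real_derivative l powr (- 1 - p)) (at l)" if "\<rho> \<le> l" for l
    proof -
      have "- 1 - p = - p - 1" by simp
      show ?thesis unfolding \<open>- 1 - p = - p - 1\<close> using assms that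
        by (auto intro!: derivative_eq_intros simp: field_simps)
    qed
    have "((\<lambda>l::real. l powr (- p)) \<longlongrightarrow> 0) at_top"
      using assms by (intro tendsto_neg_powr) (auto intro: filterlim_ident)
    from tendsto_mult_left[OF this, of "- 1 / p"]
    show "((\<lambda>l::real. - (l powr (- p)) / p) \<longlongrightarrow> 0) at_top" by simp
  qed auto
  also have "(\<integral>\<^sup>+l. ennreal (l powr (- 1 - p)) * indicator {\<rho>..} l \<partial>lborel)
     = (\<integral>\<^sup>+l. (if \<rho> \<le> l then ennreal (l powr (- 1 - p)) else 0) \<partial>lborel)"
    by (intro nn_integral_cong) (auto simp: indicator_def)
  finally show ?thesis by simp
qed

lemma nn_integral_lborel_scale:
  fixes f :: "'a::euclidean_space \<Rightarrow> ennreal"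
  assumes [measurable]: "f \<in> borel_measurable borel" and "c \<noteq> 0"
  shows "(\<integral>\<^sup>+x. f x \<partial>lborel) = ennreal (\<bar>c\<bar> ^ DIM('a)) * (\<integral>\<^sup>+x. f (c *\<^sub>R x) \<partial>lborel)"
  by (subst lborel_affine[OF \<open>c \<noteq> 0\<close>, of 0])
     (simp add: nn_integral_density nn_integral_distr nn_integral_cmult)

lemma nn_integral_lborel_uminus:
  fixes f :: "'a::euclidean_space \<Rightarrow> ennreal"
  assumes "f \<in> borel_measurable borel"
  shows "(\<integral>\<^sup>+x. f (- x) \<partial>lborel) = (\<integral>\<^sup>+x. f x \<partial>lborel)"
  using nn_integral_lborel_scale[OF assms, of "- 1"] by simp

lemma nn_integral_lborel_translate:
  fixes f :: "'a::euclidean_space \<Rightarrow> ennreal"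
  assumes [measurable]: "f \<in> borel_measurable borel"
  shows "(\<integral>\<^sup>+x. f (a + x) \<partial>lborel) = (\<integral>\<^sup>+x. f x \<partial>lborel)"
  by (subst (2) lborel_distr_plus[of a, symmetric]) (simp add: nn_integral_distr)

text \<open>A substitute for polar coordinates: insert
  \<open>1 = \<integral>\<^bsub>l \<ge> \<bar>z\<bar>\<^esub> \<bar>z\<bar> l\<^sup>-\<^sup>2 dl\<close>, exchange the integrals and rescale \<open>z = l w\<close>.\<close>

lemma nn_integral_rays:
  fixes F :: "'a::euclidean_space \<Rightarrow> ennreal"
  assumes [measurable]: "F \<in> borel_measurable borel"
  shows "(\<integral>\<^sup>+z. F z \<partial>lborel) =
    (\<integral>\<^sup>+w. (if norm w \<le> 1 then ennreal (norm w) *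
       (\<integral>\<^sup>+l. (if 0 < l then ennreal (l ^ (DIM('a) - 1)) * F (l *\<^sub>R w) else 0) \<partial>(lborel :: real measure)) else 0) \<partial>lborel)"
proof -
  have one: "(\<integral>\<^sup>+l. (if 0 < l \<and> norm z \<le> l then ennreal (norm z * l powr (- 2)) else 0) \<partial>lborel) = 1"
    if "z \<noteq> 0" for z :: 'a
  proof -
    have "(\<integral>\<^sup>+l. (if 0 < l \<and> norm z \<le> l then ennreal (norm z * l powr (- 2)) else 0) \<partial>lborel)
      = (\<integral>\<^sup>+l. ennreal (norm z) * (if norm z \<le> l then ennreal (l powr (- 1 - 1)) else 0) \<partial>lborel)"
      using that by (intro nn_integral_cong) (auto simp: ennreal_mult' intro: less_le_trans[of 0 "norm z"])
    also have "\<dots> = ennreal (norm z) * ennreal (norm z powr (- 1) / 1)"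
      using that nn_integral_powr_tail[of 1 "norm z"] by (subst nn_integral_cmult) auto
    also have "\<dots> = 1"
      using that by (simp add: powr_minus ennreal_mult[symmetric])
    finally show ?thesis .
  qed
  have "(\<integral>\<^sup>+z. F z \<partial>lborel) =
      (\<integral>\<^sup>+z. F z * (\<integral>\<^sup>+l. (if 0 < l \<and> norm z \<le> l then ennreal (norm z * l powr (- 2)) else 0) \<partial>lborel) \<partial>lborel)"
  proof (rule nn_integral_cong_AE)
    \<comment> \<open>The inserted factor equals 1 away from the origin, where it is 0.\<close>
    show "AE z in lborel. F z = F z * (\<integral>\<^sup>+l. (if 0 < l \<and> norm z \<le> l then ennreal (norm z * l powr (- 2)) else 0) \<partial>lborel)"
      using AE_lborel_singleton[of "0::'a"] by eventually_elim (simp add: one)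
  qed
  also have "\<dots> = (\<integral>\<^sup>+z. (\<integral>\<^sup>+l. F z * (if 0 < l \<and> norm z \<le> l then ennreal (norm z * l powr (- 2)) else 0) \<partial>lborel) \<partial>lborel)"
    by (intro nn_integral_cong nn_integral_cmult[symmetric]) measurable
  also have "\<dots> = (\<integral>\<^sup>+l. (\<integral>\<^sup>+z. F z * (if 0 < l \<and> norm z \<le> l then ennreal (norm z * l powr (- 2)) else 0) \<partial>lborel) \<partial>lborel)"
    by (rule lborel_pair.Fubini') measurable
  also have "\<dots> = (\<integral>\<^sup>+l. (\<integral>\<^sup>+w. (if norm w \<le> 1 \<and> 0 < l then ennreal (norm w) * (ennreal (l ^ (DIM('a) - 1)) * F (l *\<^sub>R w)) else 0)
      \<partial>(lborel :: 'a measure)) \<partial>lborel)"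
  proof (rule nn_integral_cong)
    fix l :: real
    show "(\<integral>\<^sup>+z. F z * (if 0 < l \<and> norm z \<le> l then ennreal (norm z * l powr (- 2)) else 0) \<partial>lborel)
      = (\<integral>\<^sup>+w. (if norm w \<le> 1 \<and> 0 < l then ennreal (norm w) * (ennreal (l ^ (DIM('a) - 1)) * F (l *\<^sub>R w)) else 0) \<partial>(lborel :: 'a measure))"
    proof (cases "0 < l")
      case True
      have le: "l * norm w \<le> l \<longleftrightarrow> norm w \<le> 1" for w :: 'a using True by simp
      \<comment> \<open>The Jacobian contributes \<open>l ^ DIM('a)\<close>, the rescaled norm one
        more \<open>l\<close>, and the weight \<open>l powr (- 2)\<close>; the usual radial density
        remains.\<close>
      have pw: "l ^ DIM('a) * (l * l powr (- 2)) = l ^ (DIM('a) - 1)"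
      proof -
        have "l ^ DIM('a) = l * l ^ (DIM('a) - 1)" by (metis DIM_positive power_minus_mult mult.commute)
        moreover have "l powr (- 2) = inverse (l * l)"
          using True by (simp add: powr_minus power2_eq_square)
        ultimately show ?thesis using True by (simp add: field_simps)
      qed
      have "(\<integral>\<^sup>+z. F z * (if 0 < l \<and> norm z \<le> l then ennreal (norm z * l powr (- 2)) else 0) \<partial>lborel)
        = ennreal (l ^ DIM('a)) * (\<integral>\<^sup>+w. F (l *\<^sub>R w) * (if norm w \<le> 1 then ennreal (l * norm w * l powr (- 2)) else 0) \<partial>lborel)"
        using True by (subst nn_integral_lborel_scale[where c = l]) (simp_all add: le cong: if_cong)
      also have "\<dots> = (\<integral>\<^sup>+w. ennreal (l ^ DIM('a)) * (F (l *\<^sub>R w) * (if norm w \<le> 1 then ennreal (l * norm w * l powr (- 2)) else 0)) \<partial>lborel)"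
        by (intro nn_integral_cmult[symmetric]) measurable
      also have "\<dots> = (\<integral>\<^sup>+w. (if norm w \<le> 1 \<and> 0 < l then ennreal (norm w) * (ennreal (l ^ (DIM('a) - 1)) * F (l *\<^sub>R w)) else 0) \<partial>(lborel :: 'a measure))"
      proof (intro nn_integral_cong)
        fix w :: 'a
        have "ennreal (l ^ DIM('a)) * (F (l *\<^sub>R w) * ennreal (l * norm w * l powr (- 2)))
          = (ennreal (l ^ DIM('a)) * ennreal (l * l powr (- 2))) * ennreal (norm w) * F (l *\<^sub>R w)"
          using True by (simp add: ennreal_mult mult_ac)
        also have "ennreal (l ^ DIM('a)) * ennreal (l * l powr (- 2)) = ennreal (l ^ (DIM('a) - 1))"
          using True by (simp only: pw[symmetric]) (simp add: ennreal_mult)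
        finally show "ennreal (l ^ DIM('a)) * (F (l *\<^sub>R w) * (if norm w \<le> 1 then ennreal (l * norm w * l powr (- 2)) else 0))
          = (if norm w \<le> 1 \<and> 0 < l then ennreal (norm w) * (ennreal (l ^ (DIM('a) - 1)) * F (l *\<^sub>R w)) else 0)"
          using True by (simp add: mult_ac)
      qed
      finally show ?thesis .
    qed simp
  qed
  also have "\<dots> = (\<integral>\<^sup>+w. (\<integral>\<^sup>+l. (if norm w \<le> 1 \<and> 0 < l then ennreal (norm w) * (ennreal (l ^ (DIM('a) - 1)) * F (l *\<^sub>R w)) else 0)
      \<partial>(lborel :: real measure)) \<partial>(lborel :: 'a measure))"
    by (rule lborel_pair.Fubini'[symmetric]) measurable
  also have "\<dots> = (\<integral>\<^sup>+w. (if norm w \<le> 1 then ennreal (norm w) *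
       (\<integral>\<^sup>+l. (if 0 < l then ennreal (l ^ (DIM('a) - 1)) * F (l *\<^sub>R w) else 0) \<partial>(lborel :: real measure)) else 0) \<partial>lborel)"
  proof (intro nn_integral_cong)
    fix w :: 'a
    have "(\<integral>\<^sup>+l. (if norm w \<le> 1 \<and> 0 < l then ennreal (norm w) * (ennreal (l ^ (DIM('a) - 1)) * F (l *\<^sub>R w)) else 0) \<partial>(lborel :: real measure))
       = ennreal (norm w) * (\<integral>\<^sup>+l. (if 0 < l then ennreal (l ^ (DIM('a) - 1)) * F (l *\<^sub>R w) else 0) \<partial>(lborel :: real measure))"
      if "norm w \<le> 1"
      using that by (subst nn_integral_cmult[symmetric]) (auto intro!: nn_integral_cong)
    thus "(\<integral>\<^sup>+l. (if norm w \<le> 1 \<and> 0 < l then ennreal (norm w) * (ennreal (l ^ (DIM('a) - 1)) * F (l *\<^sub>R w)) else 0) \<partial>(lborel :: real measure))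
      = (if norm w \<le> 1 then ennreal (norm w) *
       (\<integral>\<^sup>+l. (if 0 < l then ennreal (l ^ (DIM('a) - 1)) * F (l *\<^sub>R w) else 0) \<partial>(lborel :: real measure)) else 0)"
      by simp
  qed
  finally show ?thesis .
qed

text \<open>\<open>p\<close> is the component of \<open>x\<close> along \<open>w\<close>. Completing
  the square in the squared norm of \<open>x + l *\<^sub>R w\<close> shows that the sphere of radius
  \<open>R\<close> is reached after travelling the length \<open>Q - p\<close>.\<close>

lemma ray_exit:
  fixes x w :: "'a::euclidean_space" and R l :: real
  assumes "w \<noteq> 0" "norm x < R" "0 < l"
  defines "p \<equiv> (x \<bullet> w) / norm w"
  defines "Q \<equiv> sqrt (R\<^sup>2 - (norm x)\<^sup>2 + p\<^sup>2)"
  shows "\<bar>p\<bar> < Q" and "R \<le> norm (x + l *\<^sub>R w) \<longleftrightarrow> (Q - p) / norm w \<le> l"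
proof -
  have w: "0 < norm w" using assms by simp
  have R: "0 < R" using assms(2) norm_ge_zero[of x] by linarith
  have lt: "(norm x)\<^sup>2 < R\<^sup>2" using assms(2) R by (intro power_strict_mono) auto
  have Q2: "Q\<^sup>2 = R\<^sup>2 - (norm x)\<^sup>2 + p\<^sup>2" and Q0: "0 \<le> Q" using lt by (auto simp: Q_def add_nonneg_nonneg less_imp_le)
  have "p\<^sup>2 < Q\<^sup>2" using lt by (simp add: Q2)
  thus PQ: "\<bar>p\<bar> < Q" using Q0 by (metis abs_le_square_iff abs_of_nonneg not_le)
  define m where "m = l * norm w"
  have m: "0 < m" using w assms by (simp add: m_def)
  have "(norm (x + l *\<^sub>R w))\<^sup>2 = (norm x)\<^sup>2 + 2 * l * (x \<bullet> w) + l\<^sup>2 * (norm w)\<^sup>2"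
    unfolding power2_norm_eq_inner by (simp add: inner_simps inner_commute power2_eq_square algebra_simps)
  also have "2 * l * (x \<bullet> w) = 2 * m * p"
    using w by (simp add: m_def p_def)
  also have "(norm x)\<^sup>2 + 2 * m * p + l\<^sup>2 * (norm w)\<^sup>2 = (m + p)\<^sup>2 - Q\<^sup>2 + R\<^sup>2"
    unfolding Q2 by (simp add: m_def power2_eq_square algebra_simps)
  finally have eq: "(norm (x + l *\<^sub>R w))\<^sup>2 = (m + p)\<^sup>2 - Q\<^sup>2 + R\<^sup>2" .
  have "R \<le> norm (x + l *\<^sub>R w) \<longleftrightarrow> R\<^sup>2 \<le> (norm (x + l *\<^sub>R w))\<^sup>2"
    using R by (simp add: abs_le_square_iff[symmetric])
  also have "\<dots> \<longleftrightarrow> \<bar>Q\<bar> \<le> \<bar>m + p\<bar>" by (simp add: eq abs_le_square_iff)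
  \<comment> \<open>The branch \<open>m + p \<le> - Q\<close> is excluded by \<open>m > 0\<close>
    and \<open>\<bar>p\<bar> < Q\<close>.\<close>
  also have "\<dots> \<longleftrightarrow> Q - p \<le> m" using PQ m by auto
  also have "\<dots> \<longleftrightarrow> (Q - p) / norm w \<le> l" using w by (simp add: m_def pos_divide_le_eq)
  finally show "R \<le> norm (x + l *\<^sub>R w) \<longleftrightarrow> (Q - p) / norm w \<le> l" .
qed


text \<open>For \<open>norm x < R\<close>, the ray from \<open>x\<close> in the direction of \<open>w\<close> leaves the ball of radius \<open>R\<close>
  at distance \<open>exit_dist R x w\<close> from \<open>x\<close>.\<close>

definition exit_dist :: "real \<Rightarrow> 'a::euclidean_space \<Rightarrow> 'a \<Rightarrow> real" where
  "exit_dist R x w = sqrt (R\<^sup>2 - (norm x)\<^sup>2 + (x \<bullet> w / norm w)\<^sup>2) - x \<bullet> w / norm w"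

lemma borel_measurable_exit_dist [measurable]:
  fixes f g :: "'b \<Rightarrow> 'a::euclidean_space"
  assumes [measurable]: "f \<in> borel_measurable M" "g \<in> borel_measurable M"
  shows "(\<lambda>z. exit_dist R (f z) (g z)) \<in> borel_measurable M"
  unfolding exit_dist_def by measurable

text \<open>With \<open>x\<close> moved to the origin, the part of each ray outside the ball is a
  half-line. The radial density and the kernel combine to \<open>l powr (- 1 - 2 * s)\<close>, whose
  tail integral is explicit. The exit distance depends only on the direction of \<open>w\<close>;
  the power of \<open>norm w\<close> compensates for \<open>w\<close> ranging over a ball instead of
  a sphere.\<close>

lemma nn_integral_exterior:
  fixes x :: "'a::euclidean_space"
  assumes s: "0 < s" and x: "norm x < R"
  shows "(\<integral>\<^sup>+y. (if R \<le> norm y then ennreal (1 / norm (x - y) powr (real DIM('a) + 2 * s)) else 0) \<partial>lborel) =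
    (\<integral>\<^sup>+w. (if 0 < norm w \<and> norm w \<le> 1
       then ennreal (norm w powr (1 - real DIM('a)) / (2 * s) * exit_dist R x w powr (- 2 * s)) else 0) \<partial>(lborel :: 'a measure))"
proof -
  define \<alpha> where "\<alpha> = real DIM('a) + 2 * s"
  define F where "F z = (if R \<le> norm (x + z) then ennreal (1 / norm z powr \<alpha>) else 0)" for z :: 'a
  have [measurable]: "F \<in> borel_measurable borel" unfolding F_def by measurable
  have "(\<integral>\<^sup>+y. (if R \<le> norm y then ennreal (1 / norm (x - y) powr \<alpha>) else 0) \<partial>lborel) = (\<integral>\<^sup>+z. F z \<partial>lborel)"
    by (subst nn_integral_lborel_translate[where a = x, symmetric]) (auto intro!: nn_integral_cong simp: F_def)
  also have "\<dots> = (\<integral>\<^sup>+w. (if norm w \<le> 1 then ennreal (norm w) *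
       (\<integral>\<^sup>+l. (if 0 < l then ennreal (l ^ (DIM('a) - 1)) * F (l *\<^sub>R w) else 0) \<partial>(lborel :: real measure)) else 0) \<partial>lborel)"
    by (rule nn_integral_rays) measurable
  also have "\<dots> = (\<integral>\<^sup>+w. (if 0 < norm w \<and> norm w \<le> 1
       then ennreal (norm w powr (1 - real DIM('a)) / (2 * s) * exit_dist R x w powr (- 2 * s)) else 0) \<partial>(lborel :: 'a measure))"
  proof (rule nn_integral_cong)
    fix w :: 'a
    show "(if norm w \<le> 1 then ennreal (norm w) *
       (\<integral>\<^sup>+l. (if 0 < l then ennreal (l ^ (DIM('a) - 1)) * F (l *\<^sub>R w) else 0) \<partial>(lborel :: real measure)) else 0)
      = (if 0 < norm w \<and> norm w \<le> 1
       then ennreal (norm w powr (1 - real DIM('a)) / (2 * s) * exit_dist R x w powr (- 2 * s)) else 0)"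
    proof (cases "w = 0")
      case False
      define e where "e = exit_dist R x w"
      have e: "0 < e" using le_less_trans[OF abs_ge_self ray_exit(1)[OF False x, of 1]] by (simp add: e_def exit_dist_def)
      have w: "0 < norm w" using False by simp
      have "(\<integral>\<^sup>+l. (if 0 < l then ennreal (l ^ (DIM('a) - 1)) * F (l *\<^sub>R w) else 0) \<partial>(lborel :: real measure))
        = (\<integral>\<^sup>+l. ennreal (norm w powr (- \<alpha>)) * (if e / norm w \<le> l then ennreal (l powr (- 1 - 2 * s)) else 0) \<partial>lborel)"
      proof (rule nn_integral_cong)
        fix l :: real
        show "(if 0 < l then ennreal (l ^ (DIM('a) - 1)) * F (l *\<^sub>R w) else 0)
          = ennreal (norm w powr (- \<alpha>)) * (if e / norm w \<le> l then ennreal (l powr (- 1 - 2 * s)) else 0)"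
        proof (cases "0 < l")
          case True
          have "l ^ (DIM('a) - 1) = l powr (real DIM('a) - 1)"
            using True by (subst powr_realpow[symmetric]) (auto simp: of_nat_diff Suc_le_eq)
          hence "l ^ (DIM('a) - 1) * (1 / norm (l *\<^sub>R w) powr \<alpha>) = norm w powr (- \<alpha>) * (l powr (real DIM('a) - 1) * l powr (- \<alpha>))"
            using True by (simp add: powr_mult powr_minus field_simps)
          also have "l powr (real DIM('a) - 1) * l powr (- \<alpha>) = l powr (- 1 - 2 * s)"
            by (simp add: powr_add[symmetric] \<alpha>_def)
          finally have "ennreal (l ^ (DIM('a) - 1)) * ennreal (1 / norm (l *\<^sub>R w) powr \<alpha>)
            = ennreal (norm w powr (- \<alpha>)) * ennreal (l powr (- 1 - 2 * s))"
            using True by (subst (1 2) ennreal_mult[symmetric]) auto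
          thus ?thesis
            using True ray_exit(2)[OF False x True] by (simp add: F_def e_def exit_dist_def)
        next
          case f: False
          have "\<not> e / norm w \<le> l" using f divide_pos_pos[OF e w] by linarith
          thus ?thesis using f by simp
        qed
      qed
      also have "\<dots> = ennreal (norm w powr (- \<alpha>)) * ennreal ((e / norm w) powr (- (2 * s)) / (2 * s))"
        using nn_integral_powr_tail[of "2 * s" "e / norm w"] s e w by (subst nn_integral_cmult) auto
      finally have I: "(\<integral>\<^sup>+l. (if 0 < l then ennreal (l ^ (DIM('a) - 1)) * F (l *\<^sub>R w) else 0) \<partial>(lborel :: real measure))
        = ennreal (norm w powr (- \<alpha>) * ((e / norm w) powr (- (2 * s)) / (2 * s)))"
        using s by (subst ennreal_mult) auto
      have "norm w * (norm w powr (- \<alpha>) * ((e / norm w) powr (- (2 * s)) / (2 * s)))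
        = (norm w powr 1 * norm w powr (- \<alpha>) * norm w powr (2 * s)) / (2 * s) * e powr (- 2 * s)"
        using w e by (simp add: powr_divide powr_minus field_simps)
      also have "norm w powr 1 * norm w powr (- \<alpha>) * norm w powr (2 * s) = norm w powr (1 - real DIM('a))"
        by (simp only: powr_add[symmetric]) (simp add: \<alpha>_def)
      finally have "ennreal (norm w) * ennreal (norm w powr (- \<alpha>) * ((e / norm w) powr (- (2 * s)) / (2 * s)))
        = ennreal (norm w powr (1 - real DIM('a)) / (2 * s) * e powr (- 2 * s))"
        using s by (subst ennreal_mult[symmetric]) auto
      thus ?thesis using w by (simp add: I e_def)
    qed simp
  qed
  finally show ?thesis unfolding \<alpha>_def .
qed

section \<open>Power series for the interaction of a ball with the exterior of a larger one\<close>

text \<open>Here \<open>u\<close> is the starting point rescaled to the unit ball and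
  \<open>w\<close> gives the ray. The factor \<open>1 / (4 * s)\<close> is half of the
  \<open>1 / (2 * s)\<close> in \<open>nn_integral_exterior\<close>, because \<open>u\<close> and
  \<open>- u\<close> are averaged.\<close>

definition ray_coeff :: "real \<Rightarrow> 'a::euclidean_space \<Rightarrow> 'a \<Rightarrow> nat \<Rightarrow> nat \<Rightarrow> ennreal" where
  "ray_coeff s u w j i = (if norm u < 1 \<and> 0 < norm w \<and> norm w \<le> 1 then
     ennreal (norm w powr (1 - real DIM('a)) / (4 * s)) *
     ennreal (2 * neg_binom (2 * s) (2 * j) * neg_binom (s + j) i * (u \<bullet> w / norm w) ^ (2 * j)
       * ((norm u)\<^sup>2 - (u \<bullet> w / norm w)\<^sup>2) ^ i) else 0)"

lemma borel_measurable_ray_coeff [measurable]: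
  fixes f g :: "'b \<Rightarrow> 'a::euclidean_space"
  assumes [measurable]: "f \<in> borel_measurable M" "g \<in> borel_measurable M"
  shows "(\<lambda>z. ray_coeff s (f z) (g z) j i) \<in> borel_measurable M"
  unfolding ray_coeff_def by measurable

definition energy_coeff :: "'a::euclidean_space itself \<Rightarrow> real \<Rightarrow> nat \<Rightarrow> nat \<Rightarrow> ennreal" where
  "energy_coeff _ s j i = (\<integral>\<^sup>+u. \<integral>\<^sup>+w. ray_coeff s u w j i \<partial>(lborel :: 'a measure) \<partial>(lborel :: 'a measure))"

text \<open>For \<open>j = i = 0\<close> the integrand is strictly positive for every
  \<open>u\<close> in the open unit ball and every non-zero \<open>w\<close> in the unit ball. This
  coefficient later supplies strict convexity.\<close>

lemma energy_coeff_0_pos: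
  assumes s: "0 < s"
  shows "energy_coeff TYPE('a::euclidean_space) s 0 0 > 0"
proof (rule ccontr)
  assume "\<not> ?thesis"
  hence "(\<integral>\<^sup>+u. \<integral>\<^sup>+w. ray_coeff s u w 0 0 \<partial>(lborel :: 'a measure) \<partial>(lborel :: 'a measure)) = 0"
    by (simp add: energy_coeff_def)
  hence "AE u in (lborel :: 'a measure). (\<integral>\<^sup>+w. ray_coeff s u w 0 0 \<partial>(lborel :: 'a measure)) = 0"
    by (subst (asm) nn_integral_0_iff_AE) auto
  hence "AE u in (lborel :: 'a measure). u \<notin> ball 0 1"
  proof eventually_elim
    case (elim u)
    hence ae: "AE w in (lborel :: 'a measure). ray_coeff s u w 0 0 = 0"
      by (subst (asm) nn_integral_0_iff_AE) auto
    show ?case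
    proof
      assume u: "u \<in> ball 0 1"
      from ae have "AE w in (lborel :: 'a measure). w \<notin> ball 0 1"
        using AE_lborel_singleton[of "0 :: 'a"]
      proof eventually_elim
        case (elim w)
        thus ?case using s u by (auto simp: ray_coeff_def ennreal_mult[symmetric] ennreal_eq_0_iff divide_le_0_iff zero_less_mult_iff split: if_splits)
      qed
      from AE_not_in_open_imp_empty[OF _ this] show False by simp
    qed
  qed
  from AE_not_in_open_imp_empty[OF _ this] show False by simp
qed

text \<open>Measuring lengths in units of \<open>R\<close> reduces this to
  \<open>ray_series\<close>: \<open>k\<close> is the component of \<open>u\<close> along
  \<open>w\<close>, \<open>d\<close> the squared length of the orthogonal component, and
  \<open>z\<close> the ratio of the radii.\<close>

lemma ray_pair_series:
  fixes u w :: "'a::euclidean_space"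
  assumes s: "0 < s" and r: "0 < r" "r \<le> R" and u: "norm u < 1" and w: "w \<noteq> 0"
  shows "ennreal (exit_dist R (r *\<^sub>R u) w powr (- 2 * s)) + ennreal (exit_dist R (r *\<^sub>R (- u)) w powr (- 2 * s))
    = ennreal (R powr (- 2 * s)) * (\<Sum>j. \<Sum>i.
     ennreal (2 * neg_binom (2 * s) (2 * j) * neg_binom (s + j) i * (u \<bullet> w / norm w) ^ (2 * j)
       * ((norm u)\<^sup>2 - (u \<bullet> w / norm w)\<^sup>2) ^ i) * ennreal ((r / R) ^ (2 * (i + j))))"
proof -
  define k where "k = u \<bullet> w / norm w"
  define d where "d = (norm u)\<^sup>2 - k\<^sup>2"
  define z where "z = r / R"
  have R: "0 < R" using r by simp
  have rz: "r = R * z" using R by (simp add: z_def)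
  have z: "0 < z" "z \<le> 1" using r by (auto simp: z_def)
  have "\<bar>k\<bar> \<le> norm u"
    using Cauchy_Schwarz_ineq2[of u w] w by (simp add: k_def field_simps)
  hence d: "0 \<le> d" by (simp add: d_def abs_le_square_iff[symmetric])
  \<comment> \<open>Since \<open>r = R\<close> is allowed, strictness comes from \<open>u\<close>
    lying in the open unit ball.\<close>
  have "z * norm u < 1"
    using mult_right_mono[OF z(2), of "norm u"] u by simp
  hence "(z * norm u)\<^sup>2 < 1" using z by (subst power_less_one_iff) auto
  hence lt: "z\<^sup>2 * (d + k\<^sup>2) < 1" by (simp add: d_def power_mult_distrib)
  define Q where "Q = sqrt (1 - d * z\<^sup>2)"
  note ser = ray_series[OF s d z(1) lt, folded Q_def]
  have "sqrt (R\<^sup>2 - (R * z * norm u)\<^sup>2 + (R * z * k)\<^sup>2) = R * Q"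
  proof -
    have "R\<^sup>2 - (R * z * norm u)\<^sup>2 + (R * z * k)\<^sup>2 = R\<^sup>2 * (1 - d * z\<^sup>2)"
      by (simp add: d_def power_mult_distrib algebra_simps)
    thus ?thesis using R by (simp add: Q_def real_sqrt_mult)
  qed
  moreover have "(r *\<^sub>R u) \<bullet> w / norm w = R * z * k" "(r *\<^sub>R (- u)) \<bullet> w / norm w = - (R * z * k)"
    "norm (r *\<^sub>R u) = R * z * norm u" "norm (r *\<^sub>R (- u)) = R * z * norm u"
    using R z by (simp_all add: k_def rz)
  ultimately have ex: "exit_dist R (r *\<^sub>R u) w = R * (Q - z * k)" "exit_dist R (r *\<^sub>R (- u)) w = R * (Q + z * k)"
    by (simp_all only: exit_dist_def power2_minus) (simp_all add: algebra_simps)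
  have "0 < Q - z * k" "0 < Q + z * k" using ser(1) by auto
  hence "exit_dist R (r *\<^sub>R u) w powr (- 2 * s) + exit_dist R (r *\<^sub>R (- u)) w powr (- 2 * s)
     = R powr (- 2 * s) * ((Q - z * k) powr (- 2 * s) + (Q + z * k) powr (- 2 * s))"
    unfolding ex using R by (subst (1 2) powr_mult) (simp_all add: distrib_left)
  hence "ennreal (exit_dist R (r *\<^sub>R u) w powr (- 2 * s)) + ennreal (exit_dist R (r *\<^sub>R (- u)) w powr (- 2 * s))
    = ennreal (R powr (- 2 * s)) * ennreal ((Q - z * k) powr (- 2 * s) + (Q + z * k) powr (- 2 * s))"
    by (subst ennreal_mult[symmetric]) (simp_all flip: ennreal_plus)
  thus ?thesis unfolding ser(2) unfolding d_def k_def z_def .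
qed

text \<open>Integrate over the exterior first, rescale the starting point to the unit ball, and
  average over opposite starting points; then \<open>ray_pair_series\<close> can be integrated term
  by term, all terms being non-negative.\<close>

lemma annulus_energy_series:
  fixes s r R :: real
  assumes s: "0 < s" and r: "0 < r" "r \<le> R"
  shows "(\<integral>\<^sup>+y. \<integral>\<^sup>+x. (if norm x < r \<and> R \<le> norm y
        then ennreal (1 / norm (x - y) powr (real DIM('a) + 2 * s)) else 0)
        \<partial>(lborel :: 'a::euclidean_space measure) \<partial>(lborel :: 'a measure))
    = ennreal (r ^ DIM('a) * R powr (- 2 * s)) *
      (\<Sum>j. \<Sum>i. energy_coeff TYPE('a) s j i * ennreal ((r / R) ^ (2 * (i + j))))"
proof -
  define W where "W w = norm w powr (1 - real DIM('a)) / (4 * s)" for w :: 'a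
  have W: "0 \<le> W w" for w using s by (simp add: W_def)
  have [measurable]: "W \<in> borel_measurable borel" unfolding W_def by measurable
  define H where "H u w = (if norm u < 1 \<and> 0 < norm w \<and> norm w \<le> 1
    then ennreal (W w) * ennreal (exit_dist R (r *\<^sub>R u) w powr (- 2 * s)) else 0)" for u w :: 'a
  have H_meas [measurable]: "(\<lambda>z. H (f z) (g z)) \<in> borel_measurable M"
    if [measurable]: "f \<in> borel_measurable M" "g \<in> borel_measurable M" for f g :: "'c \<Rightarrow> 'a" and M
    unfolding H_def by measurable
  define G where "G x w = (if norm x < r \<and> 0 < norm w \<and> norm w \<le> 1
    then 2 * (ennreal (W w) * ennreal (exit_dist R x w powr (- 2 * s))) else 0)" for x w :: 'a
  have G_meas [measurable]: "(\<lambda>z. G (f z) (g z)) \<in> borel_measurable M"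
    if [measurable]: "f \<in> borel_measurable M" "g \<in> borel_measurable M" for f g :: "'c \<Rightarrow> 'a" and M
    unfolding G_def by measurable
  have "(\<lambda>(u, w). H u w) \<in> borel_measurable (borel \<Otimes>\<^sub>M lborel)"
      "(\<lambda>(u, w). H (- u) w) \<in> borel_measurable (borel \<Otimes>\<^sub>M lborel)"
    unfolding case_prod_beta' by measurable
  from this[THEN lborel.borel_measurable_nn_integral]
  have H1: "(\<lambda>u. \<integral>\<^sup>+w. H u w \<partial>lborel) \<in> borel_measurable borel"
    and H2: "(\<lambda>u. \<integral>\<^sup>+w. H (- u) w \<partial>lborel) \<in> borel_measurable borel" .
  have "(\<integral>\<^sup>+y. \<integral>\<^sup>+x. (if norm x < r \<and> R \<le> norm y
        then ennreal (1 / norm (x - y) powr (real DIM('a) + 2 * s)) else 0)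
        \<partial>(lborel :: 'a measure) \<partial>(lborel :: 'a measure))
    = (\<integral>\<^sup>+x. \<integral>\<^sup>+y. (if norm x < r \<and> R \<le> norm y
        then ennreal (1 / norm (x - y) powr (real DIM('a) + 2 * s)) else 0)
        \<partial>(lborel :: 'a measure) \<partial>(lborel :: 'a measure))"
    by (rule lborel_pair.Fubini') measurable
  also have "\<dots> = (\<integral>\<^sup>+x. (\<integral>\<^sup>+w. G x w \<partial>lborel) \<partial>lborel)"
  proof (rule nn_integral_cong)
    fix x :: 'a
    have g: "ennreal (norm w powr (1 - real DIM('a)) / (2 * s) * exit_dist R x w powr (- 2 * s))
      = 2 * (ennreal (W w) * ennreal (exit_dist R x w powr (- 2 * s)))" for w :: 'a
    proof -
      have "norm w powr (1 - real DIM('a)) / (2 * s) * exit_dist R x w powr (- 2 * s)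
        = 2 * (W w * exit_dist R x w powr (- 2 * s))" by (simp add: W_def field_simps)
      thus ?thesis using W[of w] by (simp add: ennreal_mult)
    qed
    show "(\<integral>\<^sup>+y. (if norm x < r \<and> R \<le> norm y
        then ennreal (1 / norm (x - y) powr (real DIM('a) + 2 * s)) else 0) \<partial>lborel) = (\<integral>\<^sup>+w. G x w \<partial>lborel)"
    proof (cases "norm x < r")
      case True
      hence "norm x < R" using r by simp
      from nn_integral_exterior[OF s this] show ?thesis using True unfolding g by (simp add: G_def)
    qed (simp add: G_def)
  qed
  also have "\<dots> = ennreal (r ^ DIM('a)) * (\<integral>\<^sup>+u. (\<integral>\<^sup>+w. G (r *\<^sub>R u) w \<partial>lborel) \<partial>lborel)"
  proof (subst nn_integral_lborel_scale[where c = r])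
    have "case_prod G \<in> borel_measurable (borel \<Otimes>\<^sub>M lborel)"
      unfolding case_prod_beta' by measurable
    thus "(\<lambda>x. \<integral>\<^sup>+w. G x w \<partial>lborel) \<in> borel_measurable borel"
      by (rule lborel.borel_measurable_nn_integral)
  qed (use r in auto)
  \<comment> \<open>The factor 2 in \<open>G\<close> offsets the halved weight \<open>W\<close>; it
    is split into two copies of \<open>H\<close> so that one of them can be reflected.\<close>
  also have "(\<integral>\<^sup>+u. (\<integral>\<^sup>+w. G (r *\<^sub>R u) w \<partial>lborel) \<partial>lborel) = (\<integral>\<^sup>+u. (\<integral>\<^sup>+w. H u w + H u w \<partial>lborel) \<partial>lborel)"
  proof (intro nn_integral_cong)
    fix u w :: 'a
    have c: "norm (r *\<^sub>R u) < r \<longleftrightarrow> norm u < 1" using r by simp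
    show "G (r *\<^sub>R u) w = H u w + H u w" unfolding G_def H_def c by (simp only: mult_2 if_distrib) simp
  qed
  also have "\<dots> = (\<integral>\<^sup>+u. (\<integral>\<^sup>+w. H u w \<partial>lborel) + (\<integral>\<^sup>+w. H u w \<partial>lborel) \<partial>lborel)"
    by (intro nn_integral_cong nn_integral_add) measurable
  also have "\<dots> = (\<integral>\<^sup>+u. (\<integral>\<^sup>+w. H u w \<partial>lborel) \<partial>lborel) + (\<integral>\<^sup>+u. (\<integral>\<^sup>+w. H u w \<partial>lborel) \<partial>lborel)"
    using H1 by (intro nn_integral_add) simp_all
  \<comment> \<open>Lebesgue measure is invariant under \<open>u \<mapsto> - u\<close>.\<close>
  also have "\<dots> = (\<integral>\<^sup>+u. (\<integral>\<^sup>+w. H u w \<partial>lborel) \<partial>lborel) + (\<integral>\<^sup>+u. (\<integral>\<^sup>+w. H (- u) w \<partial>lborel) \<partial>lborel)"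
    by (simp only: nn_integral_lborel_uminus[OF H1])
  also have "\<dots> = (\<integral>\<^sup>+u. (\<integral>\<^sup>+w. H u w \<partial>lborel) + (\<integral>\<^sup>+w. H (- u) w \<partial>lborel) \<partial>lborel)"
    using H1 H2 by (intro nn_integral_add[symmetric]) simp_all
  also have "\<dots> = (\<integral>\<^sup>+u. (\<integral>\<^sup>+w. H u w + H (- u) w \<partial>lborel) \<partial>lborel)"
    by (intro nn_integral_cong nn_integral_add[symmetric]) measurable
  also have "\<dots> = (\<integral>\<^sup>+u. (\<integral>\<^sup>+w. (\<Sum>j. \<Sum>i. ennreal (R powr (- 2 * s)) * (ray_coeff s u w j i * ennreal ((r / R) ^ (2 * (i + j))))) \<partial>lborel) \<partial>(lborel :: 'a measure))"
  proof (intro nn_integral_cong)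
    fix u w :: 'a
    show "H u w + H (- u) w = (\<Sum>j. \<Sum>i. ennreal (R powr (- 2 * s)) * (ray_coeff s u w j i * ennreal ((r / R) ^ (2 * (i + j)))))"
    proof (cases "norm u < 1 \<and> 0 < norm w \<and> norm w \<le> 1")
      case True
      define c where "c j i = ennreal (2 * neg_binom (2 * s) (2 * j) * neg_binom (s + real j) i * (u \<bullet> w / norm w) ^ (2 * j)
       * ((norm u)\<^sup>2 - (u \<bullet> w / norm w)\<^sup>2) ^ i)" for j i
      have "H u w + H (- u) w = ennreal (W w) * (ennreal (R powr (- 2 * s)) * (\<Sum>j. \<Sum>i. c j i * ennreal ((r / R) ^ (2 * (i + j)))))"
      proof -
        from True have uw: "norm u < 1" "w \<noteq> 0" by auto
        have "H u w + H (- u) w = ennreal (W w) * (ennreal (exit_dist R (r *\<^sub>R u) w powr (- 2 * s))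
            + ennreal (exit_dist R (r *\<^sub>R (- u)) w powr (- 2 * s)))"
          using True unfolding H_def norm_minus_cancel by (simp only: if_True simp_thms distrib_left)
        thus ?thesis by (simp only: ray_pair_series[OF s r uw] c_def)
      qed
      also have "\<dots> = ennreal (R powr (- 2 * s)) * (ennreal (W w) * (\<Sum>j. \<Sum>i. c j i * ennreal ((r / R) ^ (2 * (i + j)))))"
        by (simp only: mult_ac)
      also have "\<dots> = (\<Sum>j. \<Sum>i. ennreal (R powr (- 2 * s)) * (ennreal (W w) * (c j i * ennreal ((r / R) ^ (2 * (i + j))))))"
        by (simp only: ennreal_suminf_cmult)
      also have "\<dots> = (\<Sum>j. \<Sum>i. ennreal (R powr (- 2 * s)) * (ray_coeff s u w j i * ennreal ((r / R) ^ (2 * (i + j)))))"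
        using True unfolding ray_coeff_def c_def W_def by (simp only: if_True simp_thms mult.assoc)
      finally show ?thesis .
    next
      case False
      hence "H u w + H (- u) w = 0" "ray_coeff s u w j i = 0" for j i
        unfolding H_def ray_coeff_def by auto
      thus ?thesis by simp
    qed
  qed
  also have "\<dots> = (\<Sum>j. \<Sum>i. ennreal (R powr (- 2 * s)) * (energy_coeff TYPE('a) s j i * ennreal ((r / R) ^ (2 * (i + j)))))"
    by (simp add: nn_integral_suminf nn_integral_cmult nn_integral_multc energy_coeff_def)
  also have "ennreal (r ^ DIM('a)) * \<dots> = ennreal (r ^ DIM('a) * R powr (- 2 * s)) *
      (\<Sum>j. \<Sum>i. energy_coeff TYPE('a) s j i * ennreal ((r / R) ^ (2 * (i + j))))"
    using r by (simp only: ennreal_suminf_cmult) (simp add: ennreal_mult mult.assoc)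
  finally show ?thesis .
qed


section \<open>Layer-cake form of the seminorm\<close>

text \<open>The difference of two values of \<open>F\<close> is the total weight of the layers whose
  ball contains exactly one of the two points. Its square is an integral over pairs of layers. Since
  the balls are concentric, both separate the points only if one point is in the smaller ball and
  the other outside the larger. The origin is a null set, so the layers are only required to be
  integrable elsewhere.\<close>

lemma seminorm_layer_cake:
  fixes F :: "real ^ 'n \<Rightarrow> real" and w \<rho> :: "real \<Rightarrow> real"
  assumes [measurable]: "w \<in> borel_measurable borel" "\<rho> \<in> borel_measurable borel"
    and w: "\<And>m. 0 \<le> w m"
    and int: "\<And>x :: real ^ 'n. x \<noteq> 0 \<Longrightarrow> integrable lborel (\<lambda>m. if norm x < \<rho> m then w m else 0)"
    and F: "\<And>x. F x = (LINT m|lborel. (if norm x < \<rho> m then w m else 0))"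
  shows "Hs_seminorm_sq s F = (\<integral>\<^sup>+m1. \<integral>\<^sup>+m2. 2 * (ennreal (w m1) * ennreal (w m2) *
    (\<integral>\<^sup>+y. \<integral>\<^sup>+x. (if norm x < min (\<rho> m1) (\<rho> m2) \<and> max (\<rho> m1) (\<rho> m2) \<le> norm y
        then ennreal (1 / norm (x - y) powr (real CARD('n) + 2 * s)) else 0)
        \<partial>(lborel :: (real ^ 'n) measure) \<partial>(lborel :: (real ^ 'n) measure))) \<partial>lborel \<partial>lborel)"
proof -
  define N where "N x y = ennreal (1 / norm (x - y) powr (real CARD('n) + 2 * s))" for x y :: "real ^ 'n"
  have [measurable]: "(\<lambda>z. N (p z) (q z)) \<in> borel_measurable M"
    if [measurable]: "p \<in> borel_measurable M" "q \<in> borel_measurable M" for p q :: "'c \<Rightarrow> real ^ 'n" and M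
    unfolding N_def by measurable
  define k where "k x y m = (if norm x < \<rho> m \<and> \<rho> m \<le> norm y \<or> norm y < \<rho> m \<and> \<rho> m \<le> norm x
    then ennreal (w m) else 0)" for x y :: "real ^ 'n" and m
  have [measurable]: "(\<lambda>z. k (p z) (q z) (u z)) \<in> borel_measurable M"
    if [measurable]: "p \<in> borel_measurable M" "q \<in> borel_measurable M" "u \<in> borel_measurable M"
    for p q :: "'c \<Rightarrow> real ^ 'n" and u M
    unfolding k_def by measurable
  have diff: "ennreal \<bar>F x - F y\<bar> = (\<integral>\<^sup>+m. k x y m \<partial>lborel)" if "x \<noteq> 0" "y \<noteq> 0" for x y
  proof -
    have *: "ennreal \<bar>F x - F y\<bar> = (\<integral>\<^sup>+m. k x y m \<partial>lborel)"
      if xy: "x \<noteq> 0" "y \<noteq> 0" "norm x \<le> norm y" for x y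
    proof -
      let ?d = "\<lambda>m. (if norm x < \<rho> m then w m else 0) - (if norm y < \<rho> m then w m else 0)"
      have i: "integrable lborel ?d" by (intro Bochner_Integration.integrable_diff int[OF xy(1)] int[OF xy(2)])
      have nn: "0 \<le> ?d m" for m using xy w by auto
      have e: "F x - F y = (LINT m|lborel. ?d m)"
        unfolding F by (intro Bochner_Integration.integral_diff[symmetric] int[OF xy(1)] int[OF xy(2)])
      have "ennreal \<bar>F x - F y\<bar> = (\<integral>\<^sup>+m. ennreal (?d m) \<partial>lborel)"
        unfolding e using nn_integral_eq_integral[OF i] nn Bochner_Integration.integral_nonneg[OF nn] by simp
      also have "\<dots> = (\<integral>\<^sup>+m. k x y m \<partial>lborel)"
        using xy by (intro nn_integral_cong) (auto simp: k_def)
      finally show ?thesis .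
    qed
    have sym: "k y x = k x y" by (auto simp: k_def fun_eq_iff)
    show ?thesis
    proof (cases "norm x \<le> norm y")
      case True
      thus ?thesis using *[OF that] by simp
    next
      case False
      thus ?thesis using *[OF that(2,1)] by (simp add: sym abs_minus_commute)
    qed
  qed
  define K where "K = (\<lambda>(x, y, m1, m2). k x y m1 * k x y m2 * N x y)"
  have [measurable]: "K \<in> borel_measurable (borel \<Otimes>\<^sub>M borel \<Otimes>\<^sub>M borel \<Otimes>\<^sub>M borel)"
    unfolding K_def by measurable
  have sq: "ennreal (\<bar>F x - F y\<bar>\<^sup>2 / norm (x - y) powr (real CARD('n) + 2 * s))
      = (\<integral>\<^sup>+m1. \<integral>\<^sup>+m2. K (x, y, m1, m2) \<partial>lborel \<partial>lborel)" if "x \<noteq> 0" "y \<noteq> 0" for x y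
  proof -
    have "ennreal (\<bar>F x - F y\<bar>\<^sup>2 / norm (x - y) powr (real CARD('n) + 2 * s))
      = ennreal \<bar>F x - F y\<bar> * ennreal \<bar>F x - F y\<bar> * N x y"
      unfolding N_def by (simp add: ennreal_mult[symmetric] power2_eq_square)
    also have "\<dots> = (\<integral>\<^sup>+m1. k x y m1 \<partial>lborel) * ((\<integral>\<^sup>+m2. k x y m2 \<partial>lborel) * N x y)"
      unfolding diff[OF that] by (simp only: mult.assoc)
    also have "\<dots> = (\<integral>\<^sup>+m1. k x y m1 * ((\<integral>\<^sup>+m2. k x y m2 \<partial>lborel) * N x y) \<partial>lborel)"
      by (intro nn_integral_multc[symmetric]) measurable
    also have "\<dots> = (\<integral>\<^sup>+m1. k x y m1 * (\<integral>\<^sup>+m2. k x y m2 * N x y \<partial>lborel) \<partial>lborel)"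
      by (subst nn_integral_multc) auto
    also have "\<dots> = (\<integral>\<^sup>+m1. \<integral>\<^sup>+m2. k x y m1 * (k x y m2 * N x y) \<partial>lborel \<partial>lborel)"
      by (intro nn_integral_cong nn_integral_cmult[symmetric]) measurable
    finally show ?thesis by (simp add: K_def mult.assoc)
  qed
  have "Hs_seminorm_sq s F = (\<integral>\<^sup>+y. \<integral>\<^sup>+x. \<integral>\<^sup>+m1. \<integral>\<^sup>+m2. K (x, y, m1, m2) \<partial>lborel \<partial>lborel \<partial>lborel \<partial>lborel)"
    unfolding Hs_seminorm_sq_def
  proof (rule nn_integral_cong_AE)
    show "AE y in lborel. (\<integral>\<^sup>+x. ennreal (\<bar>F x - F y\<bar>\<^sup>2 / norm (x - y) powr (real CARD('n) + 2 * s)) \<partial>lborel)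
      = (\<integral>\<^sup>+x. \<integral>\<^sup>+m1. \<integral>\<^sup>+m2. K (x, y, m1, m2) \<partial>lborel \<partial>lborel \<partial>lborel)"
      using AE_lborel_singleton[of "0 :: real ^ 'n"]
    proof eventually_elim
      case (elim y)
      have "AE x in lborel. ennreal (\<bar>F x - F y\<bar>\<^sup>2 / norm (x - y) powr (real CARD('n) + 2 * s))
        = (\<integral>\<^sup>+m1. \<integral>\<^sup>+m2. K (x, y, m1, m2) \<partial>lborel \<partial>lborel)"
        using AE_lborel_singleton[of "0 :: real ^ 'n"] by eventually_elim (rule sq[OF _ elim])
      thus ?case by (rule nn_integral_cong_AE)
    qed
  qed
  \<comment> \<open>Four exchanges of neighbouring integrals bring the two layer variables to the
    outside.\<close>
  also have "\<dots> = (\<integral>\<^sup>+y. \<integral>\<^sup>+m1. \<integral>\<^sup>+x. \<integral>\<^sup>+m2. K (x, y, m1, m2) \<partial>lborel \<partial>lborel \<partial>lborel \<partial>lborel)"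
    by (intro nn_integral_cong lborel_pair.Fubini'[symmetric]) measurable
  also have "\<dots> = (\<integral>\<^sup>+m1. \<integral>\<^sup>+y. \<integral>\<^sup>+x. \<integral>\<^sup>+m2. K (x, y, m1, m2) \<partial>lborel \<partial>lborel \<partial>lborel \<partial>lborel)"
    by (rule lborel_pair.Fubini') measurable
  also have "\<dots> = (\<integral>\<^sup>+m1. \<integral>\<^sup>+y. \<integral>\<^sup>+m2. \<integral>\<^sup>+x. K (x, y, m1, m2) \<partial>lborel \<partial>lborel \<partial>lborel \<partial>lborel)"
    by (rule nn_integral_cong, rule nn_integral_cong, rule lborel_pair.Fubini'[symmetric]) measurable
  also have "\<dots> = (\<integral>\<^sup>+m1. \<integral>\<^sup>+m2. \<integral>\<^sup>+y. \<integral>\<^sup>+x. K (x, y, m1, m2) \<partial>lborel \<partial>lborel \<partial>lborel \<partial>lborel)"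
    by (rule nn_integral_cong, rule lborel_pair.Fubini') measurable
  also have "\<dots> = (\<integral>\<^sup>+m1. \<integral>\<^sup>+m2. 2 * (ennreal (w m1) * ennreal (w m2) *
    (\<integral>\<^sup>+y. \<integral>\<^sup>+x. (if norm x < min (\<rho> m1) (\<rho> m2) \<and> max (\<rho> m1) (\<rho> m2) \<le> norm y
        then N x y else 0) \<partial>lborel \<partial>lborel)) \<partial>lborel \<partial>lborel)"
  proof (rule nn_integral_cong, rule nn_integral_cong)
    fix m1 m2 :: real
    define B where "B = (\<lambda>(x, y). if norm x < min (\<rho> m1) (\<rho> m2) \<and> max (\<rho> m1) (\<rho> m2) \<le> norm y
        then N x y else 0)"
    have [measurable]: "B \<in> borel_measurable (borel \<Otimes>\<^sub>M borel)" unfolding B_def by measurable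
    define c where "c = ennreal (w m1) * ennreal (w m2)"
    have N: "N y x = N x y" for x y by (simp add: N_def norm_minus_commute)
    \<comment> \<open>The two summands are the two choices of which point lies in the smaller ball.
      They exclude each other, and the mixed cases, where the two balls contain different points,
      contradict nestedness.\<close>
    have pw: "K (x, y, m1, m2) = c * B (x, y) + c * B (y, x)" for x y
    proof -
      have "\<not> (norm x < r \<and> R \<le> norm y \<and> norm y < r \<and> R \<le> norm x)" if "r \<le> R" for r R
        using that by auto
      thus ?thesis by (auto simp: K_def k_def B_def c_def N mult.assoc)
    qed
    have "(\<integral>\<^sup>+y. \<integral>\<^sup>+x. K (x, y, m1, m2) \<partial>lborel \<partial>lborel)
      = (\<integral>\<^sup>+y. (\<integral>\<^sup>+x. c * B (x, y) \<partial>lborel) + (\<integral>\<^sup>+x. c * B (y, x) \<partial>lborel) \<partial>lborel)"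
      unfolding pw by (intro nn_integral_cong nn_integral_add) measurable
    also have "\<dots> = (\<integral>\<^sup>+y. \<integral>\<^sup>+x. c * B (x, y) \<partial>lborel \<partial>lborel) + (\<integral>\<^sup>+y. \<integral>\<^sup>+x. c * B (y, x) \<partial>lborel \<partial>lborel)"
      by (intro nn_integral_add) measurable
    \<comment> \<open>Renaming the points makes the two contributions equal, which gives the factor
      2.\<close>
    also have "(\<integral>\<^sup>+y. \<integral>\<^sup>+x. c * B (y, x) \<partial>lborel \<partial>lborel) = (\<integral>\<^sup>+y. \<integral>\<^sup>+x. c * B (x, y) \<partial>lborel \<partial>lborel)"
      by (rule lborel_pair.Fubini') measurable
    also have "(\<integral>\<^sup>+y. \<integral>\<^sup>+x. c * B (x, y) \<partial>lborel \<partial>lborel) = c * (\<integral>\<^sup>+y. \<integral>\<^sup>+x. B (x, y) \<partial>lborel \<partial>lborel)"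
      by (simp add: nn_integral_cmult)
    finally show "(\<integral>\<^sup>+y. \<integral>\<^sup>+x. K (x, y, m1, m2) \<partial>lborel \<partial>lborel) = 2 * (ennreal (w m1) * ennreal (w m2) *
    (\<integral>\<^sup>+y. \<integral>\<^sup>+x. (if norm x < min (\<rho> m1) (\<rho> m2) \<and> max (\<rho> m1) (\<rho> m2) \<le> norm y
        then N x y else 0) \<partial>lborel \<partial>lborel))"
      by (simp add: B_def c_def mult_2)
  qed
  finally show ?thesis unfolding N_def .
qed


section \<open>Convexity of the energy of a pair of layers\<close>

text \<open>\<open>ball_radius a\<close> is the radius of the ball of volume \<open>1 / a\<close>.\<close>

definition ball_radius :: "'a::euclidean_space itself \<Rightarrow> real \<Rightarrow> real" where
  "ball_radius _ a = (measure lborel (ball (0 :: 'a) 1) * a) powr (- 1 / real DIM('a))"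

text \<open>In the notation of \<open>monomial_convex\<close>, with \<open>n\<close> the dimension,
  this is \<open>p = (2 * s + 2 * k) / n\<close> and \<open>q = 2 * k / n\<close>; so
  \<open>q \<le> p\<close> holds for positive \<open>s\<close>.\<close>

definition pair_monomial :: "'a::euclidean_space itself \<Rightarrow> real \<Rightarrow> nat \<Rightarrow> real \<Rightarrow> real \<Rightarrow> real" where
  "pair_monomial _ s k a b =
     b powr (1 + (2 * s + 2 * k) / DIM('a)) * a powr (- (2 * k / DIM('a)))"

text \<open>Taken as a formal series in all \<open>a\<close> and \<open>b\<close>. For
  \<open>0 < b \<le> a\<close> it is the weighted interaction of two layers, but its convexity can
  be read off term by term from positivity of the arguments alone.\<close>

definition pair_energy :: "'a::euclidean_space itself \<Rightarrow> real \<Rightarrow> real \<Rightarrow> real \<Rightarrow> ennreal" where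
  "pair_energy T s a b = (\<Sum>j. \<Sum>i.
     ennreal (measure lborel (ball (0 :: 'a) 1) powr (2 * s / DIM('a) - 1)) * energy_coeff T s j i
       * ennreal (pair_monomial T s (i + j) a b))"

lemma unit_ball_volume_pos: "0 < measure lborel (ball (0 :: 'a::euclidean_space) 1)"
  using content_ball_pos[of 1 "0 :: 'a"] by simp

lemma ball_radius_pos: "0 < a \<Longrightarrow> 0 < ball_radius TYPE('a::euclidean_space) a"
  using unit_ball_volume_pos[where 'a = 'a] by (simp add: ball_radius_def)

lemma ball_radius_antimono:
  "0 < b \<Longrightarrow> b \<le> a \<Longrightarrow> ball_radius TYPE('a::euclidean_space) a \<le> ball_radius TYPE('a) b"
  using unit_ball_volume_pos[where 'a = 'a] unfolding ball_radius_def
  by (intro powr_mono2') auto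

text \<open>Insert the radii of the balls of volumes \<open>1 / a\<close> and \<open>1 / b\<close>
  into \<open>annulus_energy_series\<close>. The factor \<open>a\<close> cancels against
  \<open>r ^ DIM('a)\<close>, and each power of the ratio of radii becomes a power of
  \<open>b / a\<close>.\<close>

lemma pair_energy_eq:
  fixes s a b :: real
  assumes s: "0 < s" and ab: "0 < b" "b \<le> a"
  shows "ennreal a * ennreal b * (\<integral>\<^sup>+y. \<integral>\<^sup>+x.
      (if norm x < ball_radius TYPE('a::euclidean_space) a \<and> ball_radius TYPE('a) b \<le> norm y
        then ennreal (1 / norm (x - y) powr (real DIM('a) + 2 * s)) else 0)
        \<partial>(lborel :: 'a measure) \<partial>(lborel :: 'a measure)) = pair_energy TYPE('a) s a b"
proof -
  define c where "c = measure lborel (ball (0 :: 'a) 1)"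
  define n where "n = real DIM('a)"
  have n: "0 < n" by (simp add: n_def)
  have c: "0 < c" unfolding c_def by (rule unit_ball_volume_pos)
  have a: "0 < a" using ab by simp
  define r where "r = ball_radius TYPE('a) a"
  define R where "R = ball_radius TYPE('a) b"
  have rR: "0 < r" "r \<le> R" using ball_radius_pos[where 'a = 'a] a ball_radius_antimono[where 'a = 'a] ab by (auto simp: r_def R_def)
  have r: "r = (c * a) powr (- 1 / n)" and R: "R = (c * b) powr (- 1 / n)"
    by (simp_all add: r_def R_def ball_radius_def c_def n_def)
  have rn: "r ^ DIM('a) = 1 / (c * a)"
  proof -
    have "r ^ DIM('a) = r powr n" using powr_realpow[OF rR(1), of "DIM('a)"] by (simp add: n_def)
    also have "\<dots> = (c * a) powr (- 1)" unfolding r powr_powr using n by simp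
    also have "\<dots> = 1 / (c * a)" using c a by (simp add: powr_minus divide_inverse)
    finally show ?thesis .
  qed
  have Rs: "R powr (- 2 * s) = c powr (2 * s / n) * b powr (2 * s / n)"
    using c ab by (simp add: R powr_powr powr_mult)
  have ratio: "(r / R) ^ (2 * k) = b powr (2 * k / n) * a powr (- (2 * k / n))" for k
  proof -
    have "r / R = (a / b) powr (- 1 / n)" using c a ab by (simp add: r R powr_divide[symmetric])
    also have "\<dots> = (b / a) powr (1 / n)"
      using a ab by (simp add: powr_minus powr_divide field_simps)
    finally have "(r / R) ^ (2 * k) = ((b / a) powr (1 / n)) powr real (2 * k)"
      using powr_realpow[of "(b / a) powr (1 / n)" "2 * k"] a ab by simp
    also have "\<dots> = (b / a) powr (2 * k / n)" by (simp add: powr_powr)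
    finally show ?thesis using a ab by (simp add: powr_divide powr_minus field_simps)
  qed
  have coeff: "a * b * (r ^ DIM('a) * R powr (- 2 * s)) * (r / R) ^ (2 * k)
    = c powr (2 * s / n - 1) * pair_monomial TYPE('a) s k a b" for k
  proof -
    have "a * b * (r ^ DIM('a) * R powr (- 2 * s)) * (r / R) ^ (2 * k)
      = (c powr (2 * s / n) / c) * ((b powr 1 * b powr (2 * s / n) * b powr (2 * k / n)) * a powr (- (2 * k / n)))"
      unfolding rn Rs ratio using a c ab by (simp add: field_simps)
    also have "b powr 1 * b powr (2 * s / n) * b powr (2 * k / n) = b powr (1 + (2 * s + 2 * k) / n)"
      by (simp only: powr_add[symmetric] add_divide_distrib add.assoc)
    also have "c powr (2 * s / n) / c = c powr (2 * s / n - 1)"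
      using c by (simp add: powr_diff)
    finally show ?thesis by (simp add: pair_monomial_def n_def)
  qed
  have nn: "0 \<le> r ^ DIM('a) * R powr (- 2 * s)" using rR by simp
  have nn2: "0 \<le> (r / R) ^ (2 * k)" for k using rR by simp
  have "ennreal a * ennreal b * (\<integral>\<^sup>+y. \<integral>\<^sup>+x. (if norm x < r \<and> R \<le> norm y
        then ennreal (1 / norm (x - y) powr (real DIM('a) + 2 * s)) else 0)
        \<partial>(lborel :: 'a measure) \<partial>(lborel :: 'a measure))
     = ennreal (a * b * (r ^ DIM('a) * R powr (- 2 * s))) *
       (\<Sum>j. \<Sum>i. energy_coeff TYPE('a) s j i * ennreal ((r / R) ^ (2 * (i + j))))"
    unfolding annulus_energy_series[OF s rR] using a ab nn
    by (simp add: ennreal_mult mult.assoc)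
  also have "\<dots> = (\<Sum>j. \<Sum>i. energy_coeff TYPE('a) s j i *
      ennreal (a * b * (r ^ DIM('a) * R powr (- 2 * s)) * (r / R) ^ (2 * (i + j))))"
  proof -
    define A where "A = a * b * (r ^ DIM('a) * R powr (- 2 * s))"
    have "0 \<le> A" using a ab nn by (simp add: A_def)
    hence "ennreal A * (e * ennreal z) = e * ennreal (A * z)" if "0 \<le> z" for e z
      using that by (simp add: ennreal_mult mult_ac)
    thus ?thesis unfolding A_def[symmetric] by (simp only: ennreal_suminf_cmult[symmetric] nn2)
  qed
  also have "\<dots> = pair_energy TYPE('a) s a b"
    unfolding coeff pair_energy_def c_def[symmetric] n_def[symmetric]
    using c by (subst ennreal_mult) (auto simp: pair_monomial_def mult_ac)
  finally show ?thesis by (simp add: r_def R_def)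
qed

lemma ennreal_suminf_strict_mono:
  fixes x y :: "nat \<Rightarrow> ennreal"
  assumes "\<And>i. x i \<le> y i" "x k < y k" "(\<Sum>i. x i) < \<infinity>"
  shows "(\<Sum>i. x i) < (\<Sum>i. y i)"
proof -
  have "(\<integral>\<^sup>+i. x i \<partial>count_space UNIV) < (\<integral>\<^sup>+i. y i \<partial>count_space UNIV)"
    using assms by (intro nn_integral_less) (auto simp: nn_integral_count_space_nat AE_count_space not_le)
  thus ?thesis by (simp add: nn_integral_count_space_nat)
qed

lemma ennreal_suminf_linear:
  fixes x y :: "nat \<Rightarrow> ennreal"
  shows "(\<Sum>i. u * x i + v * y i) = u * (\<Sum>i. x i) + v * (\<Sum>i. y i)"
  by (subst suminf_add[symmetric]) (auto simp: ennreal_suminf_cmult)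

context
  fixes s \<mu> a0 a1 b0 b1 :: real
  assumes s: "0 < s" and \<mu>: "0 < \<mu>" "\<mu> < 1" and pos: "0 < a0" "0 < a1" "0 < b0" "0 < b1"
begin

lemma pair_monomial_convex:
  "ennreal (pair_monomial TYPE('a::euclidean_space) s k ((1 - \<mu>) * a0 + \<mu> * a1) ((1 - \<mu>) * b0 + \<mu> * b1))
    \<le> ennreal (1 - \<mu>) * ennreal (pair_monomial TYPE('a) s k a0 b0) + ennreal \<mu> * ennreal (pair_monomial TYPE('a) s k a1 b1)"
proof -
  have "pair_monomial TYPE('a) s k ((1 - \<mu>) * a0 + \<mu> * a1) ((1 - \<mu>) * b0 + \<mu> * b1)
    \<le> (1 - \<mu>) * pair_monomial TYPE('a) s k a0 b0 + \<mu> * pair_monomial TYPE('a) s k a1 b1"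
    unfolding pair_monomial_def using s \<mu> pos
    by (intro monomial_convex) (auto intro!: divide_nonneg_nonneg divide_right_mono)
  moreover have "0 \<le> pair_monomial TYPE('a) s k a b" for a b by (simp add: pair_monomial_def)
  ultimately show ?thesis using \<mu>
    by (simp add: ennreal_mult[symmetric] ennreal_plus[symmetric] ennreal_leI del: ennreal_plus)
qed

text \<open>For \<open>k = 0\<close> the exponent of \<open>a\<close> is zero, leaving a power of
  \<open>b\<close> with exponent greater than 1.\<close>

lemma pair_monomial_strict:
  assumes "b0 \<noteq> b1"
  shows "ennreal (pair_monomial TYPE('a::euclidean_space) s 0 ((1 - \<mu>) * a0 + \<mu> * a1) ((1 - \<mu>) * b0 + \<mu> * b1))
    < ennreal (1 - \<mu>) * ennreal (pair_monomial TYPE('a) s 0 a0 b0) + ennreal \<mu> * ennreal (pair_monomial TYPE('a) s 0 a1 b1)"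
proof -
  have m: "pair_monomial TYPE('a) s 0 a b = b powr (1 + 2 * s / DIM('a))" if "0 < a" for a b
    using that by (simp add: pair_monomial_def)
  have "((1 - \<mu>) * b0 + \<mu> * b1) powr (1 + 2 * s / DIM('a))
    < (1 - \<mu>) * b0 powr (1 + 2 * s / DIM('a)) + \<mu> * b1 powr (1 + 2 * s / DIM('a))"
    using s \<mu> pos assms by (intro power_strictly_convex) auto
  moreover have "0 < (1 - \<mu>) * a0 + \<mu> * a1" using convex_combination_pos \<mu> pos by blast
  ultimately show ?thesis using \<mu> pos
    by (simp add: m ennreal_mult[symmetric] ennreal_plus[symmetric] ennreal_less_iff del: ennreal_plus)
qed

lemma pair_energy_combination:
  "ennreal (1 - \<mu>) * pair_energy TYPE('a::euclidean_space) s a0 b0 + ennreal \<mu> * pair_energy TYPE('a) s a1 b1 = (\<Sum>j. \<Sum>i.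
     ennreal (measure lborel (ball (0 :: 'a) 1) powr (2 * s / DIM('a) - 1)) * energy_coeff TYPE('a) s j i *
     (ennreal (1 - \<mu>) * ennreal (pair_monomial TYPE('a) s (i + j) a0 b0) + ennreal \<mu> * ennreal (pair_monomial TYPE('a) s (i + j) a1 b1)))"
  unfolding pair_energy_def ennreal_suminf_linear[symmetric]
  by (simp add: distrib_left mult_ac)

lemma pair_energy_convex:
  "pair_energy TYPE('a::euclidean_space) s ((1 - \<mu>) * a0 + \<mu> * a1) ((1 - \<mu>) * b0 + \<mu> * b1)
    \<le> ennreal (1 - \<mu>) * pair_energy TYPE('a) s a0 b0 + ennreal \<mu> * pair_energy TYPE('a) s a1 b1"
  unfolding pair_energy_combination unfolding pair_energy_def
  by (intro suminf_le mult_left_mono pair_monomial_convex) auto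

text \<open>The series are compared term by term, with strict inequality at
  \<open>j = i = 0\<close>; finiteness of the sums carries it over to the totals.\<close>

lemma pair_energy_strict:
  assumes ne: "b0 \<noteq> b1" and fin: "pair_energy TYPE('a::euclidean_space) s a0 b0 < \<infinity>" "pair_energy TYPE('a) s a1 b1 < \<infinity>"
  shows "pair_energy TYPE('a) s ((1 - \<mu>) * a0 + \<mu> * a1) ((1 - \<mu>) * b0 + \<mu> * b1)
    < ennreal (1 - \<mu>) * pair_energy TYPE('a) s a0 b0 + ennreal \<mu> * pair_energy TYPE('a) s a1 b1"
proof -
  define C where "C j i = ennreal (measure lborel (ball (0 :: 'a) 1) powr (2 * s / DIM('a) - 1)) * energy_coeff TYPE('a) s j i" for j i
  define x where "x j i = C j i * ennreal (pair_monomial TYPE('a) s (i + j) ((1 - \<mu>) * a0 + \<mu> * a1) ((1 - \<mu>) * b0 + \<mu> * b1))" for j i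
  define y where "y j i = C j i * (ennreal (1 - \<mu>) * ennreal (pair_monomial TYPE('a) s (i + j) a0 b0)
    + ennreal \<mu> * ennreal (pair_monomial TYPE('a) s (i + j) a1 b1))" for j i
  have le: "x j i \<le> y j i" for j i
    unfolding x_def y_def by (intro mult_left_mono pair_monomial_convex) auto
  have "(\<Sum>j. \<Sum>i. x j i) = pair_energy TYPE('a) s ((1 - \<mu>) * a0 + \<mu> * a1) ((1 - \<mu>) * b0 + \<mu> * b1)"
    by (simp add: x_def C_def pair_energy_def)
  also have "\<dots> < \<infinity>"
    using fin by (intro le_less_trans[OF pair_energy_convex]) (auto simp: ennreal_mult_less_top)
  finally have xfin: "(\<Sum>j. \<Sum>i. x j i) < \<infinity>" .
  have term_le: "z k \<le> (\<Sum>i. z i)" for z :: "nat \<Rightarrow> ennreal" and k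
    using sum_le_suminf[of z "{k}"] by auto
  have C0: "0 < C 0 0"
    unfolding C_def using unit_ball_volume_pos[where 'a = 'a] energy_coeff_0_pos[OF s, where 'a = 'a]
    by (simp add: ennreal_zero_less_mult_iff)
  \<comment> \<open>The leading coefficient must be finite for multiplication by it to preserve
    strictness. It is, because its term is bounded by a finite energy and the monomial is
    positive.\<close>
  have "C 0 0 * ennreal (pair_monomial TYPE('a) s (0 + 0) a0 b0) \<le> (\<Sum>i. C 0 i * ennreal (pair_monomial TYPE('a) s (i + 0) a0 b0))"
    by (rule term_le)
  also have "\<dots> \<le> pair_energy TYPE('a) s a0 b0" unfolding pair_energy_def C_def
    by (rule term_le[of "\<lambda>j. \<Sum>i. _ j i" 0])
  also note fin(1)
  finally have "C 0 0 * ennreal (pair_monomial TYPE('a) s 0 a0 b0) < \<infinity>" by simp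
  hence C0': "C 0 0 < \<infinity>" using pos by (auto simp: ennreal_mult_less_top pair_monomial_def)
  have s0: "x 0 0 < y 0 0"
    unfolding x_def y_def using pair_monomial_strict[OF ne] C0 C0' by (intro ennreal_mult_strict_left_mono) auto
  have "(\<Sum>i. x 0 i) < (\<Sum>i. y 0 i)"
    using le s0 le_less_trans[OF term_le xfin] by (rule ennreal_suminf_strict_mono)
  hence "(\<Sum>j. \<Sum>i. x j i) < (\<Sum>j. \<Sum>i. y j i)"
    by (intro ennreal_suminf_strict_mono[where x = "\<lambda>j. \<Sum>i. x j i" and y = "\<lambda>j. \<Sum>i. y j i" and k = 0]
      xfin suminf_le le) auto
  thus ?thesis unfolding pair_energy_combination by (simp add: x_def y_def C_def pair_energy_def)
qed

end


section \<open>Integration over pairs of levels and strict convexity of the seminorm\<close>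

lemma borel_measurable_pair_energy [measurable]:
  fixes f g :: "'b \<Rightarrow> real"
  assumes [measurable]: "f \<in> borel_measurable M" "g \<in> borel_measurable M"
  shows "(\<lambda>z. pair_energy TYPE('a::euclidean_space) s (f z) (g z)) \<in> borel_measurable M"
  unfolding pair_energy_def pair_monomial_def by measurable

text \<open>Choose generic values \<open>x k\<close> tending to 1. Almost every \<open>y\<close> is
  good for all of them at once, and \<open>min (x k) y = y\<close> as soon as \<open>x k\<close>
  exceeds \<open>y\<close>.\<close>

lemma AE_min_imp_AE:
  fixes P :: "real \<Rightarrow> bool"
  assumes "AE x in lborel. AE y in lborel. x \<in> {0<..<1} \<and> y \<in> {0<..<1} \<longrightarrow> P (min x y)"
  shows "AE x in lborel. x \<in> {0<..<1} \<longrightarrow> P x"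
proof -
  have "\<exists>x. 1 - 1 / real (k + 2) < x \<and> x < 1 \<and> (AE y in lborel. x \<in> {0<..<1} \<and> y \<in> {0<..<1} \<longrightarrow> P (min x y))" for k
    by (rule AE_interval_dense) (use assms in \<open>auto elim: eventually_mono\<close>)
  then obtain x where x: "\<And>k. 1 - 1 / real (k + 2) < x k" "\<And>k. x k < 1"
    and ae: "\<And>k. AE y in lborel. x k \<in> {0<..<1} \<and> y \<in> {0<..<1} \<longrightarrow> P (min (x k) y)"
    by metis
  have "AE y in lborel. \<forall>k. x k \<in> {0<..<1} \<and> y \<in> {0<..<1} \<longrightarrow> P (min (x k) y)"
    unfolding AE_all_countable using ae by blast
  thus ?thesis
  proof eventually_elim
    case (elim y)
    show ?case
    proof
      assume y: "y \<in> {0<..<1}"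
      obtain k where "1 / real (Suc k) < 1 - y" using reals_Archimedean[of "1 - y"] y by (auto simp: inverse_eq_divide)
      moreover have "1 / real (k + 2) \<le> 1 / real (Suc k)" by (intro divide_left_mono) auto
      ultimately have "y < x k" using x(1)[of k] by linarith
      thus "P y" using elim[rule_format, of k] x(2)[of k] y by (auto simp: min_def)
    qed
  qed
qed

locale two_profiles = p0: profile f0 + p1: profile f1
  for f0 f1 :: "real ^ 'n \<Rightarrow> real"
begin

text \<open>The derivative of the interpolated height function, set to 0 outside the unit interval
  so that layer integrals run over the whole line.\<close>

definition w :: "real \<Rightarrow> real \<Rightarrow> real" where
  "w t m = (if 0 < m \<and> m < 1 then (1 - t) * p0.g m + t * p1.g m else 0)"

lemma w_pos: "0 < t \<Longrightarrow> t < 1 \<Longrightarrow> 0 < m \<Longrightarrow> m < 1 \<Longrightarrow> 0 < w t m"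
  unfolding w_def using p0.g_pos[of m] p1.g_pos[of m] by (simp add: add_pos_pos)

lemma w_mono:
  assumes "0 < t" "t < 1" "0 < m" "m \<le> m'" "m' < 1"
  shows "w t m \<le> w t m'"
  using mono_onD[OF p0.g_mono, of m m'] mono_onD[OF p1.g_mono, of m m'] assms
  by (auto simp: w_def intro!: add_mono mult_left_mono)

lemma w_measurable [measurable]: "w t \<in> borel_measurable borel"
proof -
  have "w t = (\<lambda>m. (1 - t) * (if m \<in> {0<..<1} then p0.g m else 0) + t * (if m \<in> {0<..<1} then p1.g m else 0))"
    by (auto simp: w_def)
  thus ?thesis using p0.g_measurable p1.g_measurable by simp
qed

abbreviation \<rho> :: "real \<Rightarrow> real \<Rightarrow> real" where
  "\<rho> t m \<equiv> ball_radius TYPE(real ^ 'n) (w t m)"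

lemma deriv_height_combination:
  assumes "0 < m" "m < 1" "isCont p0.g m" "isCont p1.g m"
  shows "deriv (\<lambda>m. (1 - t) * height f0 m + t * height f1 m) m = w t m"
  using p0.height_has_derivative[of m] p1.height_has_derivative[of m] assms
  by (intro DERIV_imp_deriv) (auto simp: w_def intro!: derivative_eq_intros)

text \<open>The monotone functions \<open>p0.g\<close> and \<open>p1.g\<close> are discontinuous at
  countably many levels only; elsewhere \<open>deriv\<close> of the interpolated height is
  \<open>w t\<close>.\<close>

lemma height_interpolation_eq:
  "height_interpolation f0 f1 t x = (LINT m|lborel. (if norm x < \<rho> t m then w t m else 0))"
proof -
  define X where "X = {m \<in> {0<..<1}. \<not> isCont p0.g m} \<union> {m \<in> {0<..<1}. \<not> isCont p1.g m}"
  have "countable X" unfolding X_def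
    using mono_on_ctble_discont_open[OF _ p0.g_mono] mono_on_ctble_discont_open[OF _ p1.g_mono] by auto
  thus ?thesis
    unfolding height_interpolation_def fun_of_height_def set_lebesgue_integral_def
  proof (rule integral_discrete_difference)
    fix m assume "m \<notin> X"
    show "indicator {0<..<1} m *\<^sub>R (indicator (ball 0 ((measure lborel (ball (0 :: real ^ 'n) 1) *
          deriv (\<lambda>m. (1 - t) * height f0 m + t * height f1 m) m) powr (- 1 / real CARD('n)))) x *
          deriv (\<lambda>m. (1 - t) * height f0 m + t * height f1 m) m) = (if norm x < \<rho> t m then w t m else 0)"
    proof (cases "0 < m \<and> m < 1")
      case True
      hence "deriv (\<lambda>m. (1 - t) * height f0 m + t * height f1 m) m = w t m"
        using \<open>m \<notin> X\<close> by (intro deriv_height_combination) (auto simp: X_def)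
      thus ?thesis using True by (simp add: ball_radius_def indicator_def)
    qed (auto simp: w_def)
  qed auto
qed

text \<open>A ball that reaches beyond \<open>x\<close> has volume bounded below, so its weight is
  at most a constant depending on \<open>norm x\<close>; the levels form a bounded interval.\<close>

lemma integrable_layers:
  assumes t: "0 < t" "t < 1" and x: "x \<noteq> (0 :: real ^ 'n)"
  shows "integrable lborel (\<lambda>m. if norm x < \<rho> t m then w t m else 0)"
proof -
  define c where "c = measure lborel (ball (0 :: real ^ 'n) 1)"
  define n where "n = real CARD('n)"
  have c: "0 < c" unfolding c_def by (rule unit_ball_volume_pos)
  have n: "0 < n" by (simp add: n_def)
  define b where "b = norm x powr (- n) / c"
  have le: "w t m \<le> b" if "norm x < \<rho> t m" "0 < m" "m < 1" for m
  proof -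
    have w: "0 < w t m" using w_pos t that by blast
    have "norm x < (c * w t m) powr (- 1 / n)"
      using that(1) by (simp add: ball_radius_def c_def n_def)
    hence "((c * w t m) powr (- 1 / n)) powr (- n) \<le> norm x powr (- n)"
      using x n by (intro powr_mono2') auto
    hence "c * w t m \<le> norm x powr (- n)" using n c w by (simp add: powr_powr)
    thus ?thesis using c by (simp add: b_def field_simps)
  qed
  have "0 \<le> b" using c by (simp add: b_def)
  have [measurable]: "ball_radius TYPE(real ^ 'n) \<in> borel_measurable borel"
    unfolding ball_radius_def by measurable
  show ?thesis
  proof (rule Bochner_Integration.integrable_bound)
    show "integrable lborel (\<lambda>m :: real. b * indicator {0<..<1} m :: real)"
      by (intro integrable_mult_right integrable_real_indicator) auto
    show "(\<lambda>m. if norm x < \<rho> t m then w t m else 0) \<in> borel_measurable lborel" by measurable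
    show "AE m in lborel. norm (if norm x < \<rho> t m then w t m else 0) \<le> norm (b * indicator {0<..<1} m :: real)"
    proof (rule AE_I2)
      fix m
      show "norm (if norm x < \<rho> t m then w t m else 0) \<le> norm (b * indicator {0<..<1} m :: real)"
        using le[of m] w_pos[OF t, of m] \<open>0 \<le> b\<close> by (cases "0 < m \<and> m < 1") (auto simp: w_def)
    qed
  qed
qed

text \<open>Since \<open>w t\<close> is monotone in the level, the higher level carries the larger
  weight for every \<open>t\<close>. Ordering the levels instead of the weights keeps both arguments
  of \<open>pair_energy\<close> affine in \<open>t\<close>.\<close>

definition P :: "real \<Rightarrow> real \<Rightarrow> real \<times> real \<Rightarrow> ennreal" where
  "P s t z = (if fst z \<in> {0<..<1} \<and> snd z \<in> {0<..<1}
     then 2 * pair_energy TYPE(real ^ 'n) s (w t (max (fst z) (snd z))) (w t (min (fst z) (snd z))) else 0)"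

lemma P_measurable [measurable]: "P s t \<in> borel_measurable (lborel \<Otimes>\<^sub>M lborel)"
proof -
  have "P s t \<in> borel_measurable (borel \<Otimes>\<^sub>M borel)" unfolding P_def[abs_def] by measurable
  thus ?thesis by simp
qed

text \<open>The radii are ordered oppositely to the levels, so \<open>pair_energy_eq\<close> applies
  to the layer-cake formula with the higher level as the smaller ball.\<close>

lemma seminorm_eq:
  assumes s: "0 < s" and t: "0 < t" "t < 1"
  shows "Hs_seminorm_sq s (height_interpolation f0 f1 t) = (\<integral>\<^sup>+z. P s t z \<partial>(lborel \<Otimes>\<^sub>M lborel))"
proof -
  have [measurable]: "ball_radius TYPE(real ^ 'n) \<in> borel_measurable borel"
    unfolding ball_radius_def by measurable
  have w0: "0 \<le> w t m" for m using w_pos[OF t, of m] by (cases "0 < m \<and> m < 1") (auto simp: w_def)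
  have "Hs_seminorm_sq s (height_interpolation f0 f1 t) =
    (\<integral>\<^sup>+m1. \<integral>\<^sup>+m2. 2 * (ennreal (w t m1) * ennreal (w t m2) *
    (\<integral>\<^sup>+y. \<integral>\<^sup>+x. (if norm x < min (\<rho> t m1) (\<rho> t m2) \<and> max (\<rho> t m1) (\<rho> t m2) \<le> norm y
        then ennreal (1 / norm (x - y) powr (real CARD('n) + 2 * s)) else 0)
        \<partial>(lborel :: (real ^ 'n) measure) \<partial>(lborel :: (real ^ 'n) measure))) \<partial>lborel \<partial>lborel)"
    by (rule seminorm_layer_cake[OF _ _ w0 integrable_layers[OF t] height_interpolation_eq]) measurable
  also have "\<dots> = (\<integral>\<^sup>+m1. \<integral>\<^sup>+m2. P s t (m1, m2) \<partial>lborel \<partial>lborel)"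
  proof (rule nn_integral_cong, rule nn_integral_cong)
    fix m1 m2 :: real
    define E where "E r R = (\<integral>\<^sup>+y. \<integral>\<^sup>+x. (if norm x < r \<and> R \<le> norm y
        then ennreal (1 / norm (x - y) powr (real CARD('n) + 2 * s)) else 0)
        \<partial>(lborel :: (real ^ 'n) measure) \<partial>(lborel :: (real ^ 'n) measure))" for r R
    have pe: "ennreal (w t b) * ennreal (w t a) * E (\<rho> t b) (\<rho> t a) = pair_energy TYPE(real ^ 'n) s (w t b) (w t a)"
      and le: "\<rho> t b \<le> \<rho> t a" if "0 < a" "a \<le> b" "b < 1" for a b
    proof -
      have ab: "0 < w t a" "w t a \<le> w t b" using w_pos[OF t, of a] w_mono[OF t, of a b] that by auto
      show "ennreal (w t b) * ennreal (w t a) * E (\<rho> t b) (\<rho> t a) = pair_energy TYPE(real ^ 'n) s (w t b) (w t a)"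
        unfolding E_def using pair_energy_eq[OF s ab, where 'a = "real ^ 'n"]
        by (simp only: DIM_cart DIM_real mult_1_right)
      show "\<rho> t b \<le> \<rho> t a" by (rule ball_radius_antimono[OF ab])
    qed
    have "2 * (ennreal (w t m1) * ennreal (w t m2) * E (min (\<rho> t m1) (\<rho> t m2)) (max (\<rho> t m1) (\<rho> t m2)))
      = P s t (m1, m2)"
    proof (cases "m1 \<in> {0<..<1} \<and> m2 \<in> {0<..<1}")
      case True
      show ?thesis
      proof (cases "m1 \<le> m2")
        case 1: True
        have "\<rho> t m2 \<le> \<rho> t m1" using le[of m1 m2] True 1 by simp
        thus ?thesis using True 1 pe[of m1 m2] by (simp add: P_def min_absorb2 max_absorb1 max_absorb2 min_absorb1 mult.commute)
      next
        case 1: False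
        have "\<rho> t m1 \<le> \<rho> t m2" using le[of m2 m1] True 1 by simp
        thus ?thesis using True 1 pe[of m2 m1] by (simp add: P_def min_absorb2 max_absorb1 max_absorb2 min_absorb1)
      qed
    next
      case False
      hence "w t m1 = 0 \<or> w t m2 = 0" by (auto simp: w_def)
      thus ?thesis using False by (auto simp: P_def)
    qed
    thus "2 * (ennreal (w t m1) * ennreal (w t m2) *
    (\<integral>\<^sup>+y. \<integral>\<^sup>+x. (if norm x < min (\<rho> t m1) (\<rho> t m2) \<and> max (\<rho> t m1) (\<rho> t m2) \<le> norm y
        then ennreal (1 / norm (x - y) powr (real CARD('n) + 2 * s)) else 0)
        \<partial>(lborel :: (real ^ 'n) measure) \<partial>(lborel :: (real ^ 'n) measure))) = P s t (m1, m2)"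
      unfolding E_def .
  qed
  also have "\<dots> = (\<integral>\<^sup>+z. P s t z \<partial>(lborel \<Otimes>\<^sub>M lborel))"
    by (rule lborel.nn_integral_fst) measurable
  finally show ?thesis .
qed

lemma w_affine: "w ((1 - \<mu>) * a + \<mu> * b) m = (1 - \<mu>) * w a m + \<mu> * w b m"
  by (simp add: w_def algebra_simps)

lemma P_convex:
  assumes s: "0 < s" and ab: "0 < a" "a < 1" "0 < b" "b < 1" and \<mu>: "0 < \<mu>" "\<mu> < 1"
  shows "P s ((1 - \<mu>) * a + \<mu> * b) z \<le> ennreal (1 - \<mu>) * P s a z + ennreal \<mu> * P s b z"
proof (cases "fst z \<in> {0<..<1} \<and> snd z \<in> {0<..<1}")
  case True
  hence z: "0 < max (fst z) (snd z)" "max (fst z) (snd z) < 1" "0 < min (fst z) (snd z)" "min (fst z) (snd z) < 1"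
    by auto
  show ?thesis
    using mult_left_mono[OF pair_energy_convex[OF s \<mu> w_pos[OF ab(1,2) z(1,2)] w_pos[OF ab(3,4) z(1,2)]
        w_pos[OF ab(1,2) z(3,4)] w_pos[OF ab(3,4) z(3,4)], where 'a = "real ^ 'n"], of 2] True
    by (simp add: P_def w_affine distrib_left mult.left_commute)
qed (auto simp: P_def)

lemma P_strict:
  assumes s: "0 < s" and ab: "0 < a" "a < 1" "0 < b" "b < 1" "a \<noteq> b" and \<mu>: "0 < \<mu>" "\<mu> < 1"
    and z: "fst z \<in> {0<..<1}" "snd z \<in> {0<..<1}"
    and ne: "p0.g (min (fst z) (snd z)) \<noteq> p1.g (min (fst z) (snd z))"
    and fin: "P s a z < \<infinity>" "P s b z < \<infinity>"
  shows "P s ((1 - \<mu>) * a + \<mu> * b) z < ennreal (1 - \<mu>) * P s a z + ennreal \<mu> * P s b z"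
proof -
  define M m where "M = max (fst z) (snd z)" and "m = min (fst z) (snd z)"
  have Mm: "0 < M" "M < 1" "0 < m" "m < 1" using z by (auto simp: M_def m_def)
  \<comment> \<open>\<open>pair_energy\<close> is strictly convex in its second argument, so the
    values at the lower level have to differ.\<close>
  have "w a m - w b m = (b - a) * (p0.g m - p1.g m)" using Mm by (simp add: w_def algebra_simps)
  moreover have "(b - a) * (p0.g m - p1.g m) \<noteq> 0" using ab(5) ne by (simp add: m_def)
  ultimately have w: "w a m \<noteq> w b m" by force
  have P: "P s t z = 2 * pair_energy TYPE(real ^ 'n) s (w t M) (w t m)" for t
    using z by (simp add: P_def M_def m_def)
  have fin': "pair_energy TYPE(real ^ 'n) s (w a M) (w a m) < \<infinity>" "pair_energy TYPE(real ^ 'n) s (w b M) (w b m) < \<infinity>"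
    using fin unfolding P by (auto simp: ennreal_mult_less_top)
  have "2 * pair_energy TYPE(real ^ 'n) s ((1 - \<mu>) * w a M + \<mu> * w b M) ((1 - \<mu>) * w a m + \<mu> * w b m)
    < 2 * (ennreal (1 - \<mu>) * pair_energy TYPE(real ^ 'n) s (w a M) (w a m)
        + ennreal \<mu> * pair_energy TYPE(real ^ 'n) s (w b M) (w b m))"
    using Mm ab s \<mu> w fin' by (intro ennreal_mult_strict_left_mono pair_energy_strict w_pos) auto
  thus ?thesis by (simp add: P w_affine distrib_left mult.left_commute)
qed

text \<open>Integrating \<open>P_convex\<close> gives the weak inequality. Equality would force
  \<open>P_strict\<close> to fail at almost every pair, hence \<open>p0.g\<close> and
  \<open>p1.g\<close> to agree at almost every level, and then the profiles would coincide.\<close>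

lemma seminorm_strict:
  assumes s: "0 < s" and ab: "0 < a" "a < 1" "0 < b" "b < 1" "a \<noteq> b" and \<mu>: "0 < \<mu>" "\<mu> < 1"
    and ne: "f0 \<noteq> f1"
    and fin: "Hs_seminorm_sq s (height_interpolation f0 f1 a) < \<infinity>"
      "Hs_seminorm_sq s (height_interpolation f0 f1 b) < \<infinity>"
  shows "Hs_seminorm_sq s (height_interpolation f0 f1 ((1 - \<mu>) * a + \<mu> * b))
    < ennreal (1 - \<mu>) * Hs_seminorm_sq s (height_interpolation f0 f1 a)
      + ennreal \<mu> * Hs_seminorm_sq s (height_interpolation f0 f1 b)"
proof -
  let ?M = "lborel \<Otimes>\<^sub>M lborel :: (real \<times> real) measure"
  define c where "c = (1 - \<mu>) * a + \<mu> * b"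
  have c: "0 < c" "c < 1"
    using convex_combination_pos[of a b \<mu>] convex_combination_pos[of "1 - a" "1 - b" \<mu>] ab \<mu>
    by (auto simp: c_def algebra_simps)
  let ?R = "\<lambda>z. ennreal (1 - \<mu>) * P s a z + ennreal \<mu> * P s b z"
  have R: "(\<integral>\<^sup>+z. ?R z \<partial>?M) = ennreal (1 - \<mu>) * Hs_seminorm_sq s (height_interpolation f0 f1 a)
      + ennreal \<mu> * Hs_seminorm_sq s (height_interpolation f0 f1 b)"
    using ab by (simp add: seminorm_eq[OF s] nn_integral_add nn_integral_cmult)
  have le: "P s c z \<le> ?R z" for z unfolding c_def by (rule P_convex[OF s ab(1-4) \<mu>])
  have "(\<integral>\<^sup>+z. P s c z \<partial>?M) < (\<integral>\<^sup>+z. ?R z \<partial>?M)"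
  proof (rule nn_integral_less)
    have "(\<integral>\<^sup>+z. P s c z \<partial>?M) \<le> (\<integral>\<^sup>+z. ?R z \<partial>?M)" by (intro nn_integral_mono le)
    also have "\<dots> < \<infinity>" unfolding R using fin by (auto simp: ennreal_mult_less_top)
    finally show "(\<integral>\<^sup>+z. P s c z \<partial>?M) \<noteq> \<infinity>" by simp
    show "\<not> (AE z in ?M. ?R z \<le> P s c z)"
    proof
      assume ae: "AE z in ?M. ?R z \<le> P s c z"
      \<comment> \<open>Finite energies make the integrands finite almost everywhere, as
        \<open>P_strict\<close> requires.\<close>
      have "AE z in ?M. P s a z \<noteq> \<infinity>" "AE z in ?M. P s b z \<noteq> \<infinity>"
        using fin seminorm_eq[OF s ab(1,2)] seminorm_eq[OF s ab(3,4)]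
        by (auto intro!: nn_integral_PInf_AE[unfolded infinity_ennreal_def])
      with ae have "AE z in ?M. fst z \<in> {0<..<1} \<and> snd z \<in> {0<..<1} \<longrightarrow>
        p0.g (min (fst z) (snd z)) = p1.g (min (fst z) (snd z))"
      proof eventually_elim
        case (elim z)
        thus ?case using P_strict[OF s ab \<mu>, of z] by (auto simp: c_def less_top not_le[symmetric])
      qed
      from lborel_pair.AE_pair[OF this]
      have "AE x in lborel. AE y in lborel. x \<in> {0<..<1} \<and> y \<in> {0<..<1} \<longrightarrow>
        p0.g (min x y) = p1.g (min x y)" by simp
      from AE_min_imp_AE[OF this] have "f0 = f1"
        by (rule profile_eq_of_AE_g_eq[OF p0.profile_axioms p1.profile_axioms])
      thus False using ne by contradiction
    qed
  qed (use le in auto)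
  thus ?thesis unfolding R using c by (simp add: seminorm_eq[OF s] c_def)
qed

end

theorem theorem1p4:
  fixes s :: real and f0 f1 :: "real ^ 'n \<Rightarrow> real"
  assumes "0 < s" and "s < 1"
    and "continuous_on UNIV f0" and "continuous_on UNIV f1"
    and "f0 \<noteq> f1"
    and "\<forall>x. 0 \<le> f0 x" and "\<forall>x. 0 \<le> f1 x"
    and "symmetric_decreasing f0" and "symmetric_decreasing f1"
    and "unit_mass f0" and "unit_mass f1"
  shows "strictly_convex_on {0<..<1} (\<lambda>t. Hs_seminorm_sq s (height_interpolation f0 f1 t))"
proof -
  interpret two_profiles f0 f1
    using assms by unfold_locales auto
  show ?thesis unfolding strictly_convex_on_def
    using seminorm_strict[OF \<open>0 < s\<close>] \<open>f0 \<noteq> f1\<close> by auto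
qed

end
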